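(* Let $G$ be a finite abelian group, $S\subseteq G$ a symmetric subset and $K$ the period of $\Sigma(S)$. Then $$|\Sigma(S)|\ge \frac{|S\setminus K|\,(|S\setminus K|-2)}{4}+|K|.$$
   Context: For a subset $S$ of a finite abelian group $G$, $\Sigma(S)=\{\sum_{x\in X}x : X\subseteq S\}$ is the set of all subset sums of $S$ (the empty sum $0$ is included). $S$ is symmetric if $S=-S$. The period of a subset $X\subseteq G$ is the subgroup $K(X)=\{g\in G: X+g=X\}$. *)

theory Defs
  imports Complex_Main
begin

(* intended for finite S: the sum over an infinite X would be 0 *)
definition subset_sums :: "'a::ab_group_add set \<Rightarrow> 'a set" where
  "subset_sums S = {(\<Sum>x\<in>X. x) | X. X \<subseteq> S}"

definition symmetric_set :: "'a::ab_group_add set \<Rightarrow> bool" where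
  "symmetric_set S \<longleftrightarrow> S = uminus ` S"

definition period :: "'a::ab_group_add set \<Rightarrow> 'a set" where
  "period X = {g. (\<lambda>x. x + g) ` X = X}"

end

theory Submission
  imports Defs "HOL-Library.Set_Algebras"
begin

text \<open>
  Elements of order two in \<open>S \<setminus> K\<close> would be periods of \<open>\<Sigma>(S)\<close>, so \<open>S \<setminus> K\<close> is a disjoint union
  \<open>A \<union> -A\<close> and \<open>\<Sigma>(S) = C - C\<close> for \<open>C = \<Sigma>(A) + K\<close>. By Kneser's theorem
  \<open>|\<Sigma>(S)| \<ge> 2|C| - |K|\<close>, so with \<open>m = |A|\<close> and \<open>k = |K|\<close> it suffices that \<open>|C|\<close> is at least
  \<open>m(m-1)/2 + k\<close>. This is proved by induction on \<open>m\<close>, following Olson: if \<open>|(C + a) \<setminus> C| \<le> L\<close>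
  for all \<open>a\<close> in \<open>A\<close>, subadditivity gives \<open>|(C + g) \<setminus> C| \<le> jL\<close> for \<open>g\<close> in the \<open>j\<close>-fold sumset of
  \<open>K \<union> A \<union> -A\<close>, and averaging over \<open>2|C|\<close> elements \<open>g\<close> bounds \<open>L\<close> from below, provided
  these sumsets grow by \<open>2m\<close> in each step.

  By Kneser's theorem the growth can only fail if \<open>A \<union> -A\<close> almost fills up the cosets of some
  larger subgroup \<open>H\<close> that it meets. For a maximal such \<open>H\<close> Olson's argument applies to \<open>C + H\<close>
  instead, whose gains are multiples of \<open>|H|\<close>, and yields a coset \<open>x + H\<close> such that removing
  each of about \<open>2|A \<inter> H|\<close> elements of \<open>A\<close> in \<open>x + H\<close> costs \<open>C\<close> at least
  \<open>|(A \<union> -A) + H \<setminus> H| / 2\<close> elements; the induction hypothesis for the remaining set finishes the proof.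
\<close>

section \<open>Kneser's theorem\<close>

definition subgrp :: "'a::ab_group_add set \<Rightarrow> bool" where
  "subgrp H \<longleftrightarrow> 0 \<in> H \<and> (\<forall>x\<in>H. \<forall>y\<in>H. x - y \<in> H)"

lemma subgrp_zero: "subgrp H \<Longrightarrow> 0 \<in> H"
  by (simp add: subgrp_def)

lemma subgrp_diff: "subgrp H \<Longrightarrow> x \<in> H \<Longrightarrow> y \<in> H \<Longrightarrow> x - y \<in> H"
  by (simp add: subgrp_def)

lemma subgrp_uminus: "subgrp H \<Longrightarrow> x \<in> H \<Longrightarrow> - x \<in> H"
  using subgrp_diff[of H 0 x] by (simp add: subgrp_zero)

lemma subgrp_add: "subgrp H \<Longrightarrow> x \<in> H \<Longrightarrow> y \<in> H \<Longrightarrow> x + y \<in> H"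
  using subgrp_diff[of H x "- y"] by (simp add: subgrp_uminus)

lemma subgrp_uminus_iff: "subgrp H \<Longrightarrow> - x \<in> H \<longleftrightarrow> x \<in> H"
  using subgrp_uminus[of H x] subgrp_uminus[of H "- x"] by auto

lemma subgrp_add_left_iff: "subgrp H \<Longrightarrow> h \<in> H \<Longrightarrow> h + x \<in> H \<longleftrightarrow> x \<in> H"
  using subgrp_add[of H h x] subgrp_diff[of H "h + x" h] by auto

lemma subgrp_add_right_iff: "subgrp H \<Longrightarrow> h \<in> H \<Longrightarrow> x + h \<in> H \<longleftrightarrow> x \<in> H"
  using subgrp_add_left_iff[of H h x] by (simp add: add.commute)

lemma subgrp_Int: "subgrp H \<Longrightarrow> subgrp K \<Longrightarrow> subgrp (H \<inter> K)"
  by (simp add: subgrp_def)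

lemma subgrp_plus_absorb: "subgrp H \<Longrightarrow> X \<subseteq> H \<Longrightarrow> X \<noteq> {} \<Longrightarrow> X + H = H"
proof (intro equalityI subsetI)
  fix z assume H: "subgrp H" "X \<subseteq> H" "X \<noteq> {}" and z: "z \<in> H"
  then obtain x where "x \<in> X" by blast
  with H z have "x + (z - x) \<in> X + H"
    by (intro set_plus_intro) (auto intro: subgrp_diff)
  then show "z \<in> X + H" by simp
qed (auto elim!: set_plus_elim intro: subgrp_add)

lemma subgrp_plus_self: "subgrp H \<Longrightarrow> H + H = H"
  using subgrp_plus_absorb[of H H] subgrp_zero[of H] by auto

lemma subset_plus_right: "0 \<in> Y \<Longrightarrow> X \<subseteq> X + (Y :: 'a::ab_group_add set)"
  using set_zero_plus2[of Y X] by (simp add: add.commute)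

lemma mem_singleton_plus: "z \<in> {g} + X \<longleftrightarrow> z - g \<in> (X :: 'a::ab_group_add set)"
  by (force simp: set_plus_def)

lemma card_singleton_plus [simp]: "card ({g} + X) = card (X :: 'a::ab_group_add set)"
proof -
  have "{g} + X = (\<lambda>x. g + x) ` X" by (auto simp: set_plus_def)
  then show ?thesis by (simp add: card_image)
qed

lemma singleton_plus_singleton: "{x} + {y} = {x + y :: 'a::ab_group_add}"
  by (simp add: set_plus_def)

lemma uminus_plus: "uminus ` (X + Y) = uminus ` X + uminus ` (Y :: 'a::ab_group_add set)"
  by (force simp: set_plus_def image_def)

lemma uminus_subgrp: "subgrp H \<Longrightarrow> uminus ` H = H"
proof (intro equalityI subsetI)
  fix x assume "subgrp H" "x \<in> H"
  then have "- (- x) \<in> uminus ` H" by (intro imageI subgrp_uminus)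
  then show "x \<in> uminus ` H" by simp
qed (auto intro: subgrp_uminus)

lemma period_iff: "g \<in> period X \<longleftrightarrow> {g} + X = X"
proof -
  have "{g} + X = (\<lambda>x. x + g) ` X" by (auto simp: set_plus_def add.commute)
  then show ?thesis by (simp add: period_def)
qed

text \<open>Translation preserves cardinality, so in a finite group the inclusion is already an
  equality.\<close>

lemma periodI: "{g} + X \<subseteq> X \<Longrightarrow> g \<in> period (X :: 'a::{ab_group_add,finite} set)"
  unfolding period_iff by (intro card_subset_eq) auto

lemma subgrp_period: "subgrp (period X)"
  unfolding subgrp_def
proof (intro conjI ballI)
  show "0 \<in> period X" by (simp add: period_iff)
next
  fix x y assume "x \<in> period X" "y \<in> period X"
  then have x: "{x} + X = X" and y: "{y} + X = X" by (simp_all add: period_iff)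
  have "{x - y} + X = {x - y} + ({y} + X)" using y by simp
  also have "\<dots> = {x} + X"
    by (simp add: add.assoc[symmetric] singleton_plus_singleton)
  finally show "x - y \<in> period X" using x by (simp add: period_iff)
qed

lemma period_plus: "period X + X = X"
proof (intro equalityI subsetI)
  fix z assume "z \<in> period X + X"
  then obtain g x where "g \<in> period X" "x \<in> X" "z = g + x" by (auto elim!: set_plus_elim)
  then show "z \<in> X" unfolding period_iff by blast
next
  fix z assume "z \<in> X"
  then have "0 + z \<in> period X + X"
    by (intro set_plus_intro subgrp_zero subgrp_period)
  then show "z \<in> period X + X" by simp
qed

lemma plus_period: "X + period X = X"
  using period_plus[of X] by (simp add: add.commute)

text \<open>The equation \<open>X + H = X\<close> expresses that \<open>X\<close> is a union of
  \<open>H\<close>-cosets, in a form that can be rewritten inside sums of sets.\<close>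

lemma subset_period_iff:
  fixes X :: "'a::{ab_group_add,finite} set"
  assumes "subgrp H"
  shows "H \<subseteq> period X \<longleftrightarrow> X + H = X"
proof
  assume "H \<subseteq> period X"
  then have "X + H \<subseteq> X + period X" by (intro set_plus_mono2) auto
  moreover have "X \<subseteq> X + H" using assms by (intro subset_plus_right subgrp_zero)
  ultimately show "X + H = X" by (simp add: plus_period)
next
  assume "X + H = X"
  then have "{g} + X \<subseteq> X" if "g \<in> H" for g
    using that set_plus_mono2[of "{g}" H X X] by (simp add: add.commute)
  then show "H \<subseteq> period X" by (blast intro: periodI)
qed

lemma period_plus_mono: "period X \<subseteq> period (X + Y)"
  by (auto simp: period_iff add.assoc[symmetric])

lemma period_subset: "0 \<in> X \<Longrightarrow> period X \<subseteq> X"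
  using set_plus_mono2[of "period X" "period X" "{0}" X] period_plus[of X] by force

lemma coset_eqI:
  assumes "subgrp H" "({x} + H) \<inter> ({y} + H) \<noteq> {}"
  shows "{x} + H = {y} + H"
proof -
  obtain z where z: "z - x \<in> H" "z - y \<in> H"
    using assms(2) by (auto simp: mem_singleton_plus)
  have xy: "y - x \<in> H" using subgrp_diff[OF assms(1) z] by simp
  have "w - x \<in> H \<longleftrightarrow> w - y \<in> H" for w
    using subgrp_add_right_iff[OF assms(1) xy, of "w - y"] by simp
  then show ?thesis by (auto simp: mem_singleton_plus)
qed

lemma dvd_card_periodic:
  fixes X :: "'a::{ab_group_add,finite} set"
  assumes "subgrp H" "X + H = X"
  shows "card H dvd card X"
proof -
  have "X + H = \<Union>((\<lambda>x. {x} + H) ` X)"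
    by (auto simp: set_plus_def)
  moreover have "card H dvd card (\<Union>((\<lambda>x. {x} + H) ` X))"
    using coset_eqI[OF assms(1)] by (intro dvd_partition) auto
  ultimately show ?thesis using assms(2) by simp
qed

lemma card_periodic_ge:
  fixes X :: "'a::{ab_group_add,finite} set"
  assumes "subgrp H" "X + H = X" "X \<noteq> {}"
  shows "card H \<le> card X"
  using dvd_card_periodic[OF assms(1,2)] assms(3) by (simp add: dvd_imp_le card_gt_0_iff)

section \<open>Unions of periodic sets and the Dyson transform\<close>

text \<open>The map (a, b) -> c + a + b has fibres of size at most |H1 \<inter> H2|: if a + b = a' +
  b', then a - a' = b' - b lies in both subgroups.\<close>

lemma card_subgrp_mult_le:
  fixes D :: "'a::{ab_group_add,finite} set"
  assumes "subgrp H1" "subgrp H2" "V \<subseteq> H1" "W \<subseteq> H2"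
    and D: "\<And>a b. a \<in> V \<Longrightarrow> b \<in> W \<Longrightarrow> c + a + b \<in> D"
  shows "card V * card W \<le> card (H1 \<inter> H2) * card D"
proof -
  \<comment> \<open>\<open>rep\<close> fixes one pair in each fibre. A pair is recovered from its
    sum and from the offset of its first coordinate to that representative; this is the injection
    \<open>g\<close>.\<close>
  define rep where "rep z = (SOME p. p \<in> V \<times> W \<and> c + fst p + snd p = z)" for z
  have rep: "rep (c + a + b) \<in> V \<times> W" "c + fst (rep (c + a + b)) + snd (rep (c + a + b)) = c + a + b"
    if "a \<in> V" "b \<in> W" for a b
    using someI[of "\<lambda>p. p \<in> V \<times> W \<and> c + fst p + snd p = c + a + b" "(a, b)"] that
    unfolding rep_def by auto
  define g where "g p = (fst p - fst (rep (c + fst p + snd p)), c + fst p + snd p)" for p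
  have "inj_on g (V \<times> W)"
  proof (rule inj_onI)
    fix p q assume "g p = g q"
    then have "c + fst p + snd p = c + fst q + snd q"
      "fst p - fst (rep (c + fst p + snd p)) = fst q - fst (rep (c + fst q + snd q))"
      by (auto simp: g_def)
    then show "p = q" by (metis add_left_cancel diff_add_cancel prod.expand)
  qed
  moreover have "g ` (V \<times> W) \<subseteq> (H1 \<inter> H2) \<times> D"
  proof
    fix q assume "q \<in> g ` (V \<times> W)"
    then obtain a b where ab: "a \<in> V" "b \<in> W" and q: "q = g (a, b)" by auto
    obtain a' b' where ab': "rep (c + a + b) = (a', b')" by force
    have *: "a' \<in> V" "b' \<in> W" "c + a' + b' = c + a + b" using rep[OF ab] ab' by auto
    then have "a - a' = b' - b" by (simp add: algebra_simps)
    moreover have "a - a' \<in> H1" using ab * assms by (blast intro: subgrp_diff)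
    moreover have "b' - b \<in> H2" using ab * assms by (blast intro: subgrp_diff)
    ultimately show "q \<in> (H1 \<inter> H2) \<times> D" using q ab' D[OF ab] by (simp add: g_def)
  qed
  ultimately have "card (V \<times> W) \<le> card ((H1 \<inter> H2) \<times> D)"
    by (intro card_inj_on_le) auto
  then show ?thesis by (simp add: card_cartesian_product)
qed

text \<open>
  A coset \<open>c + H1 + H2\<close> is a grid of cosets of \<open>H1 \<inter> H2\<close>, in which \<open>C2\<close> consists of full columns
  (indexed by \<open>V\<close>) and \<open>C1\<close> of full rows (indexed by \<open>U\<close>).
\<close>

lemma kneser_union_aux:
  fixes C1 C2 :: "'a::{ab_group_add,finite} set"
  defines "H1 \<equiv> period C1" and "H2 \<equiv> period C2"
  assumes ne: "\<not> C2 \<subseteq> C1"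
    and small1: "card (C2 - C1) + card (H1 \<inter> H2) < card H1"
    and small2: "card (C1 - C2) + card (H1 \<inter> H2) < card H2"
  shows "card H2 \<le> card (C2 - C1)"
proof -
  obtain c where c: "c \<in> C2" "c \<notin> C1" using ne by blast
  define h where "h = card (H1 \<inter> H2)"
  define V where "V = {a \<in> H1. c + a \<in> C2}"
  define U where "U = {b \<in> H2. c + b \<in> C1}"
  have s: "subgrp H1" "subgrp H2" "subgrp (H1 \<inter> H2)"
    by (auto simp: H1_def H2_def subgrp_period intro: subgrp_Int)
  have sh1: "a + z \<in> C1 \<longleftrightarrow> z \<in> C1" if "a \<in> H1" for a z
    using that by (simp add: H1_def period_iff) (metis add_diff_cancel_left' mem_singleton_plus)
  have sh2: "a + z \<in> C2 \<longleftrightarrow> z \<in> C2" if "a \<in> H2" for a z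
    using that by (simp add: H2_def period_iff) (metis add_diff_cancel_left' mem_singleton_plus)
  have hpos: "h > 0"
    using subgrp_zero[OF s(3)] by (auto simp: h_def card_gt_0_iff)
  \<comment> \<open>A nonempty set invariant under \<open>H1 \<inter> H2\<close> contains a whole
    cell of the grid, and a cell has \<open>h\<close> elements.\<close>
  have per: "h \<le> card X" if "X \<noteq> {}" "\<And>x t. x \<in> X \<Longrightarrow> t \<in> H1 \<inter> H2 \<Longrightarrow> x + t \<in> X" for X :: "'a set"
  proof -
    have "X + (H1 \<inter> H2) = X"
      using that(2) subset_plus_right[OF subgrp_zero[OF s(3)], of X] by (auto elim!: set_plus_elim)
    then show ?thesis using card_periodic_ge[OF s(3)] that(1) by (simp add: h_def)
  qed
  have V: "0 \<in> V" using c s by (simp add: V_def subgrp_zero)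
  have hV: "h \<le> card V"
  proof (rule per)
    fix x t assume "x \<in> V" "t \<in> H1 \<inter> H2"
    then show "x + t \<in> V"
      using sh2[of t "c + x"] s by (auto simp: V_def algebra_simps intro: subgrp_add)
  qed (use V in auto)
  have U0: "0 \<in> H2 - U" using c s by (simp add: U_def subgrp_zero)
  have ha: "h \<le> card (H2 - U)"
  proof (rule per)
    fix x t assume "x \<in> H2 - U" "t \<in> H1 \<inter> H2"
    then show "x + t \<in> H2 - U"
      using sh1[of t "c + x"] s by (auto simp: U_def algebra_simps intro: subgrp_add)
  qed (use U0 in auto)
  \<comment> \<open>A cell in a column of \<open>C2\<close> but in no row of \<open>C1\<close>
    belongs to \<open>C2 - C1\<close>; \<open>e2\<close> is the same count with the roles
    exchanged.\<close>
  have e1: "card V * card (H2 - U) \<le> h * card (C2 - C1)"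
    unfolding h_def
  proof (rule card_subgrp_mult_le[OF s(1,2)])
    fix a b assume "a \<in> V" "b \<in> H2 - U"
    then show "c + a + b \<in> C2 - C1"
      using sh1[of a "c + b"] sh2[of b "c + a"] by (auto simp: U_def V_def algebra_simps)
  qed (auto simp: V_def)
  have e2: "card (H1 - V) * card U \<le> h * card (C1 - C2)"
    unfolding h_def
  proof (rule card_subgrp_mult_le[OF s(1,2)])
    fix a b assume "a \<in> H1 - V" "b \<in> U"
    then show "c + a + b \<in> C1 - C2"
      using sh1[of a "c + b"] sh2[of b "c + a"] by (auto simp: U_def V_def algebra_simps)
  qed (auto simp: U_def)
  have c1: "card H1 = card V + card (H1 - V)"
    using card_Diff_subset[of V H1] card_mono[of H1 V] by (simp add: V_def)
  have c2: "card H2 = card U + card (H2 - U)"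
    using card_Diff_subset[of U H2] card_mono[of H2 U] by (simp add: U_def)
  show ?thesis
  proof (cases "U = {}")
    case True
    have "h * card H2 \<le> card V * card H2" using hV by simp
    also have "\<dots> \<le> h * card (C2 - C1)" using e1 True by simp
    finally show ?thesis using hpos by simp
  next
    case False
    have hU: "h \<le> card U"
    proof (rule per)
      fix x t assume "x \<in> U" "t \<in> H1 \<inter> H2"
      then show "x + t \<in> U"
        using sh1[of t "c + x"] s by (auto simp: U_def algebra_simps intro: subgrp_add)
    qed (use False in auto)
    have "H1 - V \<noteq> {}"
    proof
      assume "H1 - V = {}"
      then have "card H1 = card V" using c1 by simp
      then have "card H1 * h \<le> card V * card (H2 - U)"
        using mult_left_mono[OF ha, of "card V"] by simp
      also have "\<dots> \<le> h * card (C2 - C1)" by (rule e1)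
      finally show False using hpos small1 by (simp add: mult.commute)
    qed
    then have hb: "h \<le> card (H1 - V)"
    proof (rule per)
      fix x t assume "x \<in> H1 - V" "t \<in> H1 \<inter> H2"
      then show "x + t \<in> H1 - V"
        using sh2[of t "c + x"] s by (auto simp: V_def algebra_simps intro: subgrp_add)
    qed
    \<comment> \<open>All four index sets now have at least \<open>h\<close> elements. Under this
      condition \<open>e1\<close> and \<open>small1\<close> force \<open>a < b\<close>, while
      \<open>e2\<close> and \<open>small2\<close> force \<open>b < a\<close>.\<close>
    define a b v u where "a = int (card (H2 - U))" "b = int (card (H1 - V))"
      "v = int (card V)" "u = int (card U)"
    note d = this
    have hh: "int h \<le> a" "int h \<le> b" "int h \<le> v" "int h \<le> u" using ha hb hV hU d by auto
    have "int (card (C2 - C1)) < v + b - int h" using small1 c1 d by (simp add: h_def)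
    then have "int h * int (card (C2 - C1)) < int h * (v + b - int h)" using hpos by simp
    moreover have "v * a \<le> int h * int (card (C2 - C1))"
      using e1 d by (metis of_nat_mult of_nat_le_iff)
    ultimately have "v * (a - int h) < int h * (b - int h)" by (simp add: algebra_simps)
    moreover have "int h * (a - int h) \<le> v * (a - int h)" using hh by (intro mult_right_mono) auto
    ultimately have "int h * (a - int h) < int h * (b - int h)" by linarith
    then have "a < b" using hpos by (simp add: mult_less_cancel_left_pos)
    have "int (card (C1 - C2)) < u + a - int h" using small2 c2 d by (simp add: h_def)
    then have "int h * int (card (C1 - C2)) < int h * (u + a - int h)" using hpos by simp
    moreover have "b * u \<le> int h * int (card (C1 - C2))"
      using e2 d by (metis of_nat_mult of_nat_le_iff)
    ultimately have "u * (b - int h) < int h * (a - int h)" by (simp add: algebra_simps)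
    moreover have "int h * (b - int h) \<le> u * (b - int h)" using hh by (intro mult_right_mono) auto
    ultimately have "int h * (b - int h) < int h * (a - int h)" by linarith
    then have "b < a" using hpos by (simp add: mult_less_cancel_left_pos)
    with \<open>a < b\<close> show ?thesis by simp
  qed
qed

text \<open>The period of the union contains the intersection of the two periods. Unless one set
  contains the other, the elements that one of them gains make up for the loss of period.\<close>

lemma kneser_union:
  fixes C1 C2 :: "'a::{ab_group_add,finite} set"
  assumes "N \<le> card C1 + card (period C1)" "N \<le> card C2 + card (period C2)"
  shows "N \<le> card (C1 \<union> C2) + card (period (C1 \<union> C2))"
proof -
  let ?H = "period C1 \<inter> period C2"
  have "?H \<subseteq> period (C1 \<union> C2)"
    by (auto simp: period_iff set_plus_Un)
  then have H: "card ?H \<le> card (period (C1 \<union> C2))" by (intro card_mono) auto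
  have un: "card (C1 \<union> C2) = card C1 + card (C2 - C1)" "card (C1 \<union> C2) = card C2 + card (C1 - C2)"
    by (metis Un_Diff_cancel card_Un_disjoint Diff_disjoint finite_code)
       (metis Un_Diff_cancel Un_commute card_Un_disjoint Diff_disjoint finite_code)
  consider "C2 \<subseteq> C1" | "C1 \<subseteq> C2" | "\<not> C2 \<subseteq> C1" "\<not> C1 \<subseteq> C2" by blast
  then show ?thesis
  proof cases
    case 3
    \<comment> \<open>With Hi the period of Ci: if both alternatives fail,
      \<open>kneser_union_aux\<close> used in both directions gives |H2| \<le> |C2 - C1| < |H1| and
      |H1| \<le> |C1 - C2| < |H2|.\<close>
    have "card (period C1) \<le> card (C2 - C1) + card ?H \<or> card (period C2) \<le> card (C1 - C2) + card ?H"
    proof (rule ccontr)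
      assume "\<not> ?thesis"
      then have s: "card (C2 - C1) + card ?H < card (period C1)" "card (C1 - C2) + card ?H < card (period C2)"
        by auto
      have "card (period C2) \<le> card (C2 - C1)" by (rule kneser_union_aux[OF 3(1) s])
      moreover have "card (period C1) \<le> card (C1 - C2)"
        using kneser_union_aux[OF 3(2)] s by (simp add: Int_commute)
      ultimately show False using s by linarith
    qed
    then show ?thesis using assms H un by linarith
  qed (use assms in \<open>auto simp: Un_absorb1 Un_absorb2\<close>)
qed

lemma kneser_Union:
  fixes F :: "'a::{ab_group_add,finite} set set"
  assumes "finite F" "F \<noteq> {}" "\<And>C. C \<in> F \<Longrightarrow> N \<le> card C + card (period C)"
  shows "N \<le> card (\<Union>F) + card (period (\<Union>F))"
  using assms
proof (induction F rule: finite_ne_induct)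
  case (insert C F)
  then have "N \<le> card (C \<union> \<Union>F) + card (period (C \<union> \<Union>F))"
    by (intro kneser_union) auto
  then show ?case by simp
qed auto

text \<open>Induction on |B|. If \<open>e + B\<close> is not inside \<open>A\<close> for some
  \<open>e\<close> in \<open>A\<close>, pass to A \<union> (e + B) and B \<inter> (A - e): the total
  size is kept, the sumset does not grow, and the second set shrinks. If there is no such
  \<open>e\<close>, then \<open>B\<close> consists of periods of \<open>A\<close>, and
  \<open>C = A\<close> works.\<close>

lemma dyson_transform:
  fixes A B :: "'a::{ab_group_add,finite} set"
  assumes "0 \<in> B" "c \<in> A"
  shows "\<exists>C. c \<in> C \<and> C \<subseteq> A + B \<and> card A + card B \<le> card C + card (period C)"
  using assms
proof (induction "card B" arbitrary: A B rule: less_induct)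
  case less
  show ?case
  proof (cases "A + B \<subseteq> A")
    case True
    then have "B \<subseteq> period A"
      by (auto intro!: periodI elim!: set_plus_elim) (metis add.commute set_plus_intro subsetD)
    then have "card B \<le> card (period A)" by (intro card_mono) auto
    then show ?thesis using less.prems subset_plus_right[of B A] by (intro exI[of _ A]) auto
  next
    case False
    then obtain e b0 where e: "e \<in> A" "b0 \<in> B" "e + b0 \<notin> A" by (auto elim!: set_plus_elim)
    define A' where "A' = A \<union> ({e} + B)"
    define B' where "B' = {b \<in> B. e + b \<in> A}"
    have sub: "B' \<subseteq> B" and "b0 \<in> B - B'" using e by (auto simp: B'_def)
    then have lt: "card B' < card B" by (intro psubset_card_mono) auto
    have "({e} + B) - A = {e} + (B - B')"
      by (auto simp: mem_singleton_plus B'_def)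
    then have "card A' = card A + card (B - B')"
      unfolding A'_def by (metis Un_Diff_cancel card_Un_disjoint Diff_disjoint finite_code card_singleton_plus)
    moreover have "card (B - B') = card B - card B'" "card B' \<le> card B"
      using sub by (simp_all add: card_Diff_subset card_mono)
    ultimately have card: "card A' + card B' = card A + card B" by simp
    have "A' + B' \<subseteq> A + B"
    proof
      fix z assume "z \<in> A' + B'"
      then obtain a b where z: "z = a + b" "a \<in> A'" "b \<in> B'" by (auto elim!: set_plus_elim)
      show "z \<in> A + B"
      proof (cases "a \<in> A")
        case False
        \<comment> \<open>The shift by \<open>e\<close> moves to the other summand:
          \<open>e + b\<close> lies in \<open>A\<close> by the choice of \<open>B'\<close>, and
          \<open>a - e\<close> lies in \<open>B\<close>.\<close>
        then have "(e + b) + (a - e) \<in> A + B"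
          using z by (intro set_plus_intro) (auto simp: A'_def B'_def mem_singleton_plus)
        then show ?thesis using z by (simp add: algebra_simps)
      qed (use z sub in blast)
    qed
    moreover have "\<exists>C. c \<in> C \<and> C \<subseteq> A' + B' \<and> card A' + card B' \<le> card C + card (period C)"
      using less.prems e lt by (intro less.hyps) (auto simp: A'_def B'_def)
    ultimately show ?thesis using card by (metis order_trans)
  qed
qed

text \<open>By the Dyson transform every element of the sumset lies in a subset \<open>C\<close> of
  it for which |C| + |period C| is large. The union of these subsets is the whole sumset, and
  \<open>kneser_Union\<close> carries the bound over.\<close>

theorem kneser:
  fixes A B :: "'a::{ab_group_add,finite} set"
  assumes "A \<noteq> {}" "B \<noteq> {}"
  defines "P \<equiv> period (A + B)"
  shows "card (A + P) + card (B + P) \<le> card (A + B) + card P"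
proof -
  define X Y where "X = A + P" and "Y = B + P"
  have P: "subgrp P" by (simp add: P_def subgrp_period)
  have XY: "X + Y = A + B"
  proof -
    have "X + Y = (A + B) + (P + P)" by (simp add: X_def Y_def ac_simps)
    also have "\<dots> = A + B" using P by (simp add: subgrp_plus_self P_def plus_period)
    finally show ?thesis .
  qed
  have "\<exists>C. c \<in> C \<and> C \<subseteq> X + Y \<and> card X + card Y \<le> card C + card (period C)" if c: "c \<in> X + Y" for c
  proof -
    obtain x y where xy: "x \<in> X" "y \<in> Y" "c = x + y" using c by (auto elim!: set_plus_elim)
    \<comment> \<open>Translating by \<open>y\<close> and \<open>-y\<close> moves 0 into the second
      summand; the two shifts cancel in the sum.\<close>
    have "\<exists>C. c \<in> C \<and> C \<subseteq> ({y} + X) + ({-y} + Y) \<and>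
        card ({y} + X) + card ({-y} + Y) \<le> card C + card (period C)"
      using xy by (intro dyson_transform) (auto simp: mem_singleton_plus)
    moreover have "({y} + X) + ({-y} + Y) = ({y} + {-y}) + (X + Y)" by (simp only: ac_simps)
    moreover have "{y} + {-y} = (0 :: 'a set)" by (simp add: singleton_plus_singleton)
    ultimately show ?thesis by simp
  qed
  then obtain f where f: "\<And>c. c \<in> X + Y \<Longrightarrow> c \<in> f c \<and> f c \<subseteq> X + Y \<and> card X + card Y \<le> card (f c) + card (period (f c))"
    by metis
  then have "X + Y = \<Union>(f ` (X + Y))" by blast
  moreover have "X + Y \<noteq> {}" using XY assms by (auto simp: set_plus_def)
  then have "card X + card Y \<le> card (\<Union>(f ` (X + Y))) + card (period (\<Union>(f ` (X + Y))))"
    using f by (intro kneser_Union) auto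
  ultimately show ?thesis using XY by (simp add: X_def Y_def P_def)
qed

section \<open>Olson's inequality\<close>

primrec iter_plus :: "'a::ab_group_add set \<Rightarrow> 'a set \<Rightarrow> nat \<Rightarrow> 'a set" where
  "iter_plus H X 0 = H"
| "iter_plus H X (Suc j) = iter_plus H X j + X"

lemma iter_plus_add: "iter_plus H X j + Y = iter_plus (H + Y) X j"
proof (induction j)
  case (Suc j)
  have "iter_plus H X (Suc j) + Y = (iter_plus H X j + Y) + X" by (simp add: ac_simps)
  then show ?case using Suc by simp
qed simp

lemma iter_plus_mono: "0 \<in> X \<Longrightarrow> i \<le> j \<Longrightarrow> iter_plus H X i \<subseteq> iter_plus H X j"
  by (rule lift_Suc_mono_le[of "iter_plus H X"]) (simp_all add: subset_plus_right)

lemma iter_plus_subset: "subgrp G \<Longrightarrow> H \<subseteq> G \<Longrightarrow> X \<subseteq> G \<Longrightarrow> iter_plus H X j \<subseteq> G"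
proof (induction j)
  case (Suc j)
  then have "iter_plus H X j + X \<subseteq> G + G" by (intro set_plus_mono2) auto
  then show ?case using Suc.prems by (simp add: subgrp_plus_self)
qed simp

text \<open>Induction on \<open>j\<close> with \<open>P\<close> varying, because the hypothesis is
  applied to the period P' of T = P + (j+1)X. If X \<subseteq> P', then T = G. Otherwise Kneser's
  theorem for (P + jX) + X gives |T| \<ge> |P' + jX| + |X + P'| - |P'|, and \<open>grow\<close>
  makes the last two terms contribute at least \<open>d\<close>.\<close>

lemma iter_plus_growth:
  fixes X :: "'a::{ab_group_add,finite} set"
  assumes G: "subgrp G" "X \<subseteq> G" "\<And>Q. subgrp Q \<Longrightarrow> X \<subseteq> Q \<Longrightarrow> H \<subseteq> Q \<Longrightarrow> G \<subseteq> Q"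
    and X0: "0 \<in> X"
    and grow: "\<And>P. subgrp P \<Longrightarrow> H \<subseteq> P \<Longrightarrow> P \<subseteq> G \<Longrightarrow> \<not> X \<subseteq> P \<Longrightarrow> d + card P \<le> card (X + P)"
    and P: "subgrp P" "H \<subseteq> P" "P \<subseteq> G"
  shows "card P + d * j \<le> card (iter_plus P X j) \<or> iter_plus P X j = G"
  using P
proof (induction j arbitrary: P)
  case (Suc j)
  define T where "T = iter_plus P X (Suc j)"
  define P' where "P' = period T"
  have P': "subgrp P'" by (simp add: P'_def subgrp_period)
  have "T + P = T"
    using Suc.prems by (simp only: T_def iter_plus_add subgrp_plus_self)
  then have PP': "P \<subseteq> P'" using Suc.prems by (simp add: P'_def subset_period_iff)
  have "P \<subseteq> T" unfolding T_def using iter_plus_mono[OF X0, of 0 "Suc j" P] by simp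
  then have "0 \<in> T" using Suc.prems subgrp_zero by blast
  then have P'T: "P' \<subseteq> T" by (simp add: P'_def period_subset)
  have TG: "T \<subseteq> G" unfolding T_def by (rule iter_plus_subset[OF G(1) Suc.prems(3) G(2)])
  show ?case
  proof (cases "X \<subseteq> P'")
    case True
    then have "G \<subseteq> P'" using G(3) P' PP' Suc.prems by blast
    then show ?thesis using P'T TG T_def by blast
  next
    case False
    have PPP: "P + P' = P'"
      using subgrp_plus_absorb[OF P' PP'] Suc.prems subgrp_zero by blast
    have it: "iter_plus P X j + P' = iter_plus P' X j"
      by (simp only: iter_plus_add PPP)
    have "iter_plus P' X j + X = T + P'"
      unfolding T_def iter_plus.simps it[symmetric] by (simp add: ac_simps)
    then have sub: "iter_plus P' X j \<subseteq> T"
      using subset_plus_right[OF X0, of "iter_plus P' X j"] by (simp add: P'_def plus_period)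
    have "X \<noteq> {}" "iter_plus P X j \<noteq> {}"
      using X0 iter_plus_mono[OF X0, of 0 j P] subgrp_zero[OF Suc.prems(1)] by auto
    then have k: "card (iter_plus P' X j) + card (X + P') \<le> card T + card P'"
      using kneser[of "iter_plus P X j" X] it by (simp add: T_def P'_def)
    have "card P' + d * j \<le> card (iter_plus P' X j) \<or> iter_plus P' X j = G"
      using Suc.prems P' PP' P'T TG by (intro Suc.IH) auto
    then show ?thesis
    proof
      assume "iter_plus P' X j = G"
      then show ?thesis using sub TG T_def by blast
    next
      assume "card P' + d * j \<le> card (iter_plus P' X j)"
      moreover have "d + card P' \<le> card (X + P')"
        using False P' PP' P'T TG Suc.prems by (intro grow) auto
      moreover have "card P \<le> card P'" using PP' by (intro card_mono) auto
      ultimately show ?thesis using k by (simp add: T_def)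
    qed
  qed
qed auto

section \<open>Olson's function and the averaging argument\<close>

text \<open>This is Olson's function \<lambda>_C(g). In a finite group it is symmetric and
  subadditive in \<open>g\<close>, and it is exactly what \<open>C\<close> gains when the summand
  {0, g} is added.\<close>

definition shift_gain :: "'a::ab_group_add set \<Rightarrow> 'a \<Rightarrow> nat" where
  "shift_gain C g = card (({g} + C) - C)"

lemma shift_gain_period: "g \<in> period C \<Longrightarrow> shift_gain C g = 0"
  by (simp add: shift_gain_def period_iff)

lemma shift_gain_eq:
  "shift_gain C g = card C - card (C \<inter> ({g} + C))" for C :: "'a::{ab_group_add,finite} set"
  using card_Diff_subset_Int[of "{g} + C" C] by (simp add: shift_gain_def Int_commute)

lemma shift_gain_eq_Diff:
  "shift_gain C g = card (C - ({g} + C))" for C :: "'a::{ab_group_add,finite} set"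
  using card_Diff_subset_Int[of C "{g} + C"] by (simp add: shift_gain_eq)

lemma shift_gain_uminus: "shift_gain C (- g) = shift_gain C g" for C :: "'a::{ab_group_add,finite} set"
proof -
  have "{g} + (C \<inter> ({- g} + C)) = C \<inter> ({g} + C)"
    by (auto simp: mem_singleton_plus)
  then show ?thesis using card_singleton_plus[of g "C \<inter> ({- g} + C)"] by (simp add: shift_gain_eq)
qed

lemma shift_gain_add: "shift_gain C (x + y) \<le> shift_gain C x + shift_gain C y"
  for C :: "'a::{ab_group_add,finite} set"
proof -
  have "({x + y} + C) - C \<subseteq> ({x} + (({y} + C) - C)) \<union> (({x} + C) - C)"
    by (auto simp: mem_singleton_plus diff_diff_eq)
  then have "shift_gain C (x + y) \<le> card (({x} + (({y} + C) - C)) \<union> (({x} + C) - C))"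
    unfolding shift_gain_def by (intro card_mono) auto
  also have "\<dots> \<le> card ({x} + (({y} + C) - C)) + card (({x} + C) - C)" by (rule card_Un_le)
  finally show ?thesis by (simp add: shift_gain_def)
qed

text \<open>The complement gains what \<open>C\<close> loses, and under a translation
  \<open>C\<close> loses as many points as it gains. This allows a set larger than half of
  \<open>G\<close> to be replaced by its complement.\<close>

lemma shift_gain_compl:
  fixes G :: "'a::{ab_group_add,finite} set"
  assumes "subgrp G" "C \<subseteq> G" "g \<in> G"
  shows "shift_gain (G - C) g = shift_gain C g"
proof -
  have "z - g \<in> G \<longleftrightarrow> z \<in> G" for z
    using subgrp_add_right_iff[OF assms(1,3), of "z - g"] by simp
  then have "({g} + (G - C)) - (G - C) = C - ({g} + C)"
    using assms(2) by (auto simp: mem_singleton_plus)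
  then show ?thesis unfolding shift_gain_eq_Diff[of C] by (simp add: shift_gain_def)
qed

lemma plus_pair: "C + {0, y} = C \<union> ({y} + C)" for C :: "'a::ab_group_add set"
proof -
  have "C + {0, y} = C + ({0} \<union> {y})" by (simp add: insert_is_Un[of 0 "{y}"])
  then show ?thesis by (simp only: set_plus_Un set_zero[symmetric] add_0_right add.commute)
qed

text \<open>Moving C \<union> (y + C) by \<open>y\<close> yields new points only from the part
  \<open>y + C\<close>, and these are translates of points gained by \<open>C\<close>.\<close>

lemma shift_gain_plus_pair:
  "shift_gain (C + {0, y}) y \<le> shift_gain C y" for C :: "'a::{ab_group_add,finite} set"
proof -
  have "({y} + (C + {0, y})) - (C + {0, y}) \<subseteq> {y} + (({y} + C) - C)"
    unfolding plus_pair by (auto simp: mem_singleton_plus)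
  then have "shift_gain (C + {0, y}) y \<le> card ({y} + (({y} + C) - C))"
    unfolding shift_gain_def by (intro card_mono) auto
  then show ?thesis by (simp add: shift_gain_def)
qed

lemma card_plus_pair:
  "card (C + {0, y}) = card C + shift_gain C y" for C :: "'a::{ab_group_add,finite} set"
proof -
  have "C + {0, y} = C \<union> (({y} + C) - C)"
    by (auto simp: plus_pair)
  moreover have "card (C \<union> (({y} + C) - C)) = card C + card (({y} + C) - C)"
    by (intro card_Un_disjoint) auto
  ultimately show ?thesis by (simp only: shift_gain_def)
qed

text \<open>Both sides count pairs of elements of \<open>C\<close>; on the left they are sorted by
  their difference.\<close>

lemma sum_card_Int_shift:
  "(\<Sum>g\<in>UNIV. card (C \<inter> ({g} + C))) = (card C)\<^sup>2" for C :: "'a::{ab_group_add,finite} set"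
proof -
  have "C \<inter> ({g} + C) = {x \<in> C. x - g \<in> C}" for g
    by (auto simp only: mem_singleton_plus)
  then have "(\<Sum>g\<in>UNIV. card (C \<inter> ({g} + C))) = (\<Sum>g\<in>UNIV. \<Sum>x\<in>{x \<in> C. x - g \<in> C}. 1)"
    by simp
  also have "\<dots> = (\<Sum>x\<in>C. \<Sum>g\<in>{g \<in> UNIV. x - g \<in> C}. 1)"
    by (rule sum.swap_restrict) auto
  also have "\<dots> = (\<Sum>x\<in>C. card C)"
  proof (intro sum.cong refl)
    fix x
    have "{g \<in> UNIV. x - g \<in> C} = (\<lambda>z. x - z) ` C"
      by (force simp: image_def)
    then show "(\<Sum>g\<in>{g \<in> UNIV. x - g \<in> C}. 1) = card C"
      by (simp add: card_image inj_on_def)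
  qed
  finally show ?thesis by (simp add: power2_eq_square)
qed

lemma shift_gain_iter_plus:
  fixes C :: "'a::{ab_group_add,finite} set"
  assumes "H \<subseteq> period C" "\<And>x. x \<in> X \<Longrightarrow> real (shift_gain C x) \<le> L" "g \<in> iter_plus H X j"
  shows "real (shift_gain C g) \<le> real j * L"
  using assms(3)
proof (induction j arbitrary: g)
  case 0
  then show ?case using assms(1) shift_gain_period by fastforce
next
  case (Suc j)
  then obtain t x where "g = t + x" "t \<in> iter_plus H X j" "x \<in> X" by (auto elim!: set_plus_elim)
  then show ?case
    using Suc.IH[of t] assms(2)[of x] shift_gain_add[of C t x] by (simp add: algebra_simps)
qed

text \<open>Sum Olson's function over a set \<open>W\<close> of 2|C| elements. Double counting makes
  the sum at least |C|^2. By subadditivity an element reached after \<open>j\<close> steps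
  contributes at most \<open>j * L\<close>, and the growth forces elements to be reached
  early.\<close>

lemma olson_inequality:
  fixes C :: "'a::{ab_group_add,finite} set"
  assumes X0: "0 \<in> X" and H: "H \<subseteq> period C"
    and L: "\<And>x. x \<in> X \<Longrightarrow> real (shift_gain C x) \<le> L"
    and grow: "\<And>j. card H + d * j \<le> card (iter_plus H X j) \<or> iter_plus H X j = G"
    and G: "2 * card C \<le> card G" and d: "d > 0"
  shows "8 * real d * (real (card C))\<^sup>2 \<le> L * (4 * real (card C) - 2 * real (card H) + real d)\<^sup>2"
proof -
  define c where "c = card C"
  define T where "T = iter_plus H X"
  have mono: "T i \<subseteq> T j" if "i \<le> j" for i j
    unfolding T_def by (rule iter_plus_mono[OF X0 that])
  have L0: "0 \<le> L" using L[OF X0] by linarith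
  \<comment> \<open>\<open>2 * c\<close> steps are enough: either each step accounts for at least
    one element, or all of \<open>G\<close> has been reached.\<close>
  have "\<exists>j. 2 * c \<le> card (T j)"
  proof (intro exI[of _ "2 * c"])
    have "2 * c \<le> d * (2 * c)" using d by simp
    moreover have "card H + d * (2 * c) \<le> card (T (2 * c)) \<or> card (T (2 * c)) = card G"
      using grow[of "2 * c"] unfolding T_def by blast
    ultimately show "2 * c \<le> card (T (2 * c))" using G unfolding c_def by linarith
  qed
  then obtain j0 where j0: "2 * c \<le> card (T j0)" "\<And>j. j < j0 \<Longrightarrow> card (T j) < 2 * c"
    using exists_least_iff[of "\<lambda>j. 2 * c \<le> card (T j)"] by (auto simp: not_le)
  \<comment> \<open>\<open>T0\<close> is the last stage with fewer than \<open>2 * c\<close>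
    elements; for \<open>j0 = 0\<close> there is none, hence the empty set.\<close>
  define T0 where "T0 = (if j0 = 0 then {} else T (j0 - 1))"
  have "card T0 \<le> 2 * c" using j0(2)[of "j0 - 1"] by (cases j0) (auto simp: T0_def)
  moreover have "T0 \<subseteq> T j0" using mono[of "j0 - 1" j0] by (simp add: T0_def)
  \<comment> \<open>\<open>W\<close> has exactly \<open>2c\<close> elements and is filled up from the centre, so the distances to the centre are minimal\<close>
  ultimately obtain W where W: "T0 \<subseteq> W" "W \<subseteq> T j0" "card W = 2 * c"
    using exists_subset_between[of T0 "2 * c" "T j0"] j0(1) by auto
  have TW: "T j \<subseteq> W" if "j < j0" for j
    using mono[of j "j0 - 1"] W(1) that by (cases j0) (auto simp: T0_def less_Suc_eq_le)
  \<comment> \<open>The number of stages before \<open>j0\<close> that miss \<open>g\<close> is at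
    least the number of steps to \<open>g\<close>, and it can be summed stage by stage.\<close>
  have upper: "real (shift_gain C g) \<le> L * real (card {j \<in> {..<j0}. g \<notin> T j})" if "g \<in> W" for g
  proof -
    have "\<exists>i. g \<in> T i" using that W by blast
    then obtain i where i: "g \<in> T i" "\<And>j. j < i \<Longrightarrow> g \<notin> T j"
      using exists_least_iff[of "\<lambda>i. g \<in> T i"] by blast
    have "i \<le> j0" using i(2)[of j0] that W by (meson not_le subsetD)
    then have "{..<i} \<subseteq> {j \<in> {..<j0}. g \<notin> T j}" using i by auto
    then have "card {..<i} \<le> card {j \<in> {..<j0}. g \<notin> T j}" by (intro card_mono) auto
    then have "real i * L \<le> L * real (card {j \<in> {..<j0}. g \<notin> T j})"
      using L0 by (simp add: mult.commute mult_left_mono)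
    moreover have "real (shift_gain C g) \<le> real i * L"
      using shift_gain_iter_plus[OF H L] i(1) unfolding T_def by blast
    ultimately show ?thesis by linarith
  qed
  \<comment> \<open>\<open>E\<close> is the sum of 2c - |H| - dj over all j < j0, the bound for the
    total number of misses.\<close>
  define E where "E = real j0 * (2 * real c - real (card H)) - real d * (real j0 * (real j0 - 1) / 2)"
  define M where "M = 2 * real c - real (card H)"
  have "(\<Sum>g\<in>W. card {j \<in> {..<j0}. g \<notin> T j}) = (\<Sum>j<j0. card {g \<in> W. g \<notin> T j})"
    using sum.swap_restrict[of W "{..<j0}" "\<lambda>_ _. 1 :: nat" "\<lambda>g j. g \<notin> T j"] by simp
  moreover have "real (card {g \<in> W. g \<notin> T j}) \<le> M - real d * real j" if "j < j0" for j
  proof -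
    have "{g \<in> W. g \<notin> T j} = W - T j" by auto
    then have "card {g \<in> W. g \<notin> T j} = 2 * c - card (T j)"
      using TW[OF that] W(3) by (simp add: card_Diff_subset)
    moreover have "card H + d * j \<le> card (T j)"
      using grow[of j] j0(2)[OF that] G unfolding T_def c_def by auto
    then have "real (card H) + real d * real j \<le> real (card (T j))"
      by (metis of_nat_add of_nat_le_iff of_nat_mult)
    ultimately show ?thesis using j0(2)[OF that] by (simp add: M_def of_nat_diff)
  qed
  then have "(\<Sum>j<j0. real (card {g \<in> W. g \<notin> T j})) \<le> (\<Sum>j<j0. M - real d * real j)"
    by (intro sum_mono) auto
  moreover have "(\<Sum>j<j0. M - real d * real j) = real j0 * M - real d * (real j0 * (real j0 - 1) / 2)"
    by (induction j0) (auto simp: field_simps)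
  ultimately have s: "real (\<Sum>g\<in>W. card {j \<in> {..<j0}. g \<notin> T j})
      \<le> E"
    by (simp add: E_def M_def)
  define a where "a = M + real d / 2"
  \<comment> \<open>Completing the square eliminates \<open>j0\<close>: the two sides differ by the
    square of \<open>a - d * j0\<close>.\<close>
  have am: "2 * real d * E \<le> a\<^sup>2"
    using zero_le_power2[of "a - real d * real j0"]
    by (simp add: a_def E_def M_def power2_eq_square field_simps)
  have "(\<Sum>g\<in>W. card (C \<inter> ({g} + C))) \<le> (\<Sum>g\<in>UNIV. card (C \<inter> ({g} + C)))"
    by (intro sum_mono2) auto
  then have "(\<Sum>g\<in>W. real (card (C \<inter> ({g} + C)))) \<le> (real c)\<^sup>2"
    unfolding sum_card_Int_shift c_def by (metis of_nat_le_iff of_nat_power of_nat_sum)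
  moreover have "(\<Sum>g\<in>W. real (shift_gain C g)) = (\<Sum>g\<in>W. real c - real (card (C \<inter> ({g} + C))))"
    by (intro sum.cong refl) (simp add: shift_gain_eq c_def of_nat_diff card_mono)
  then have "(\<Sum>g\<in>W. real (shift_gain C g)) = 2 * (real c)\<^sup>2 - (\<Sum>g\<in>W. real (card (C \<inter> ({g} + C))))"
    using W(3) by (simp add: sum_subtractf power2_eq_square)
  moreover have "(\<Sum>g\<in>W. real (shift_gain C g)) \<le> L * real (\<Sum>g\<in>W. card {j \<in> {..<j0}. g \<notin> T j})"
    using sum_mono[OF upper, of W] by (simp add: sum_distrib_left)
  moreover have "L * real (\<Sum>g\<in>W. card {j \<in> {..<j0}. g \<notin> T j})
      \<le> L * E"
    using s L0 by (rule mult_left_mono)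
  ultimately have "(real c)\<^sup>2 \<le> L * E"
    by linarith
  then have "2 * real d * (real c)\<^sup>2 \<le> 2 * real d * (L * E)"
    by (intro mult_left_mono) auto
  also have "\<dots> = L * (2 * real d * E)"
    by (simp only: ac_simps)
  also have "\<dots> \<le> L * a\<^sup>2" using am L0 by (rule mult_left_mono)
  finally have "4 * (2 * real d * (real c)\<^sup>2) \<le> L * (4 * a\<^sup>2)" by simp
  also have "4 * a\<^sup>2 = (4 * real c - 2 * real (card H) + real d)\<^sup>2"
    by (simp add: a_def M_def power2_eq_square algebra_simps)
  finally show ?thesis by (simp add: c_def)
qed

section \<open>Subset sums of a half of a symmetric set\<close>

lemma subset_sums_mono: "A \<subseteq> B \<Longrightarrow> subset_sums A \<subseteq> subset_sums B"
  by (auto simp: subset_sums_def)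

lemma zero_in_subset_sums: "0 \<in> subset_sums A"
  unfolding subset_sums_def by (intro CollectI exI[of _ "{}"]) simp

lemma subset_subset_sums: "A \<subseteq> subset_sums A"
proof
  fix x assume "x \<in> A"
  then show "x \<in> subset_sums A"
    unfolding subset_sums_def by (intro CollectI exI[of _ "{x}"]) simp
qed

lemma subset_sums_empty [simp]: "subset_sums {} = {0}"
  by (auto simp: subset_sums_def)

lemma subset_sums_singleton: "subset_sums {a} = {0, a}"
proof
  show "subset_sums {a} \<subseteq> {0, a}" by (auto simp: subset_sums_def subset_singleton_iff)
  show "{0, a} \<subseteq> subset_sums {a}" using zero_in_subset_sums subset_subset_sums[of "{a}"] by auto
qed

lemma subset_sums_Un:
  fixes A B :: "'a::{ab_group_add,finite} set"
  assumes "A \<inter> B = {}"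
  shows "subset_sums (A \<union> B) = subset_sums A + subset_sums B"
proof (intro equalityI subsetI)
  fix z assume "z \<in> subset_sums (A \<union> B)"
  then obtain X where X: "X \<subseteq> A \<union> B" "z = \<Sum>X" by (auto simp: subset_sums_def)
  have "z = \<Sum>((X \<inter> A) \<union> (X \<inter> B))" using X by (simp add: Int_Un_distrib[symmetric] Int_absorb2)
  also have "\<dots> = \<Sum>(X \<inter> A) + \<Sum>(X \<inter> B)" using assms by (intro sum.union_disjoint) auto
  finally show "z \<in> subset_sums A + subset_sums B"
    by (auto simp: subset_sums_def intro!: set_plus_intro)
next
  fix z assume "z \<in> subset_sums A + subset_sums B"
  then obtain X Y where XY: "X \<subseteq> A" "Y \<subseteq> B" "z = \<Sum>X + \<Sum>Y"
    by (auto simp: subset_sums_def elim!: set_plus_elim)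
  then have "z = \<Sum>(X \<union> Y)" using assms by (subst sum.union_disjoint) auto
  then show "z \<in> subset_sums (A \<union> B)" using XY by (auto simp: subset_sums_def)
qed

lemma subset_sums_Diff:
  "B \<subseteq> A \<Longrightarrow> subset_sums A = subset_sums B + subset_sums (A - B)"
  for A B :: "'a::{ab_group_add,finite} set"
  using subset_sums_Un[of B "A - B"] by (simp add: Un_absorb1)

lemma subset_sums_remove:
  "a \<in> A \<Longrightarrow> subset_sums A = subset_sums (A - {a}) + {0, a}"
  for A :: "'a::{ab_group_add,finite} set"
  using subset_sums_Diff[of "{a}" A] by (simp add: subset_sums_singleton add.commute)

lemma subset_sums_uminus: "subset_sums (uminus ` A) = uminus ` subset_sums A"
proof -
  have s: "(\<Sum>x\<in>uminus ` X. x) = - \<Sum>X" for X :: "'a set"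
    by (simp add: sum.reindex sum_negf)
  have "subset_sums (uminus ` A) = {(\<Sum>x\<in>uminus ` X. x) | X. X \<subseteq> A}"
    unfolding subset_sums_def by (metis (no_types, lifting) subset_image_iff image_mono)
  also have "\<dots> = uminus ` subset_sums A"
    unfolding s subset_sums_def by auto
  finally show ?thesis .
qed

text \<open>Complementing \<open>X\<close> in \<open>A\<close> turns \<Sum>X into \<Sum>A - \<Sum>X,
  so changing all signs merely translates the set of subset sums.\<close>

lemma subset_sums_uminus_shift:
  "subset_sums (uminus ` A) = {- \<Sum>A} + subset_sums A" for A :: "'a::{ab_group_add,finite} set"
proof -
  have d: "\<Sum>(A - X) = \<Sum>A - \<Sum>X" if "X \<subseteq> A" for X
    using that by (simp add: sum_diff)
  have "z \<in> uminus ` subset_sums A \<longleftrightarrow> z + \<Sum>A \<in> subset_sums A" for z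
  proof
    assume "z \<in> uminus ` subset_sums A"
    then obtain X where "X \<subseteq> A" "z = - \<Sum>X" by (auto simp: subset_sums_def)
    then show "z + \<Sum>A \<in> subset_sums A"
      using d[of X] unfolding subset_sums_def by (intro CollectI exI[of _ "A - X"]) auto
  next
    assume "z + \<Sum>A \<in> subset_sums A"
    then obtain X where "X \<subseteq> A" "z + \<Sum>A = \<Sum>X" by (auto simp: subset_sums_def)
    then have "z = \<Sum>X - \<Sum>A" by (metis add_diff_cancel_right')
    then have "z = - \<Sum>(A - X)" using d[OF \<open>X \<subseteq> A\<close>] by simp
    then show "z \<in> uminus ` subset_sums A"
      by (auto simp: subset_sums_def)
  qed
  then show ?thesis by (intro set_eqI) (simp add: subset_sums_uminus mem_singleton_plus)
qed

lemma subset_sums_subgrp: "subgrp H \<Longrightarrow> A \<subseteq> H \<Longrightarrow> subset_sums A \<subseteq> H"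
proof
  fix z assume H: "subgrp H" "A \<subseteq> H" "z \<in> subset_sums A"
  then obtain X where X: "X \<subseteq> A" "z = \<Sum>X" by (auto simp: subset_sums_def)
  have "\<Sum>Y \<in> H" if "finite Y" "Y \<subseteq> H" for Y
    using that by (induction Y rule: finite_induct) (auto intro: subgrp_zero subgrp_add H(1))
  \<comment> \<open>A sum over an infinite set has the default value 0, which lies in
    \<open>H\<close>.\<close>
  moreover have "\<Sum>X = 0" if "infinite X" using that by simp
  ultimately show "z \<in> H" using X H subgrp_zero by (metis order_trans)
qed

text \<open>Pigeonhole: for \<open>z\<close> in the coset, \<open>X\<close> and \<open>z - Y\<close>
  both lie in it and are too large to be disjoint.\<close>

lemma plus_eq_coset:
  fixes X Y Q :: "'a::{ab_group_add,finite} set"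
  assumes Q: "subgrp Q" and X: "X \<subseteq> {x} + Q" and Y: "Y \<subseteq> Q" and card: "card Q < card X + card Y"
  shows "X + Y = {x} + Q"
proof (intro equalityI subsetI)
  fix z assume "z \<in> X + Y"
  then have "z \<in> ({x} + Q) + Q" using X Y by (blast intro: set_plus_mono2 subsetD)
  then show "z \<in> {x} + Q" by (simp add: add.assoc subgrp_plus_self[OF Q])
next
  fix z assume z: "z \<in> {x} + Q"
  define Y' where "Y' = (\<lambda>y. z - y) ` Y"
  have "card Y' = card Y" unfolding Y'_def by (intro card_image) (auto simp: inj_on_def)
  moreover have "Y' \<subseteq> {x} + Q"
  proof
    fix w assume "w \<in> Y'"
    then obtain y where "y \<in> Y" and "w = z - y" by (auto simp: Y'_def)
    from \<open>y \<in> Y\<close> have "(z - x) - y \<in> Q"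
      by (intro subgrp_diff[OF Q, of "z - x"]) (use z Y in \<open>auto simp: mem_singleton_plus\<close>)
    moreover have "w - x = (z - x) - y" using \<open>w = z - y\<close> by (simp add: algebra_simps)
    ultimately show "w \<in> {x} + Q" by (simp only: mem_singleton_plus)
  qed
  then have "card (X \<union> Y') \<le> card ({x} + Q)" using X by (intro card_mono) auto
  ultimately have "X \<inter> Y' \<noteq> {}"
    using card card_Un_disjoint[of X Y'] by auto
  then obtain y where "z - y \<in> X" "y \<in> Y" by (auto simp: Y'_def)
  then have "(z - y) + y \<in> X + Y" by (rule set_plus_intro)
  then show "z \<in> X + Y" by simp
qed

section \<open>Halves relative to a subgroup K\<close>

text \<open>
  Adding \<open>K\<close> replaces the passage to the quotient by \<open>K\<close>, where the image of \<open>A\<close> would be a multiset.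
\<close>

definition aperiodic_half :: "'a::ab_group_add set \<Rightarrow> 'a set \<Rightarrow> bool" where
  "aperiodic_half K A \<longleftrightarrow> A \<inter> uminus ` A = {} \<and> A \<inter> K = {} \<and>
     period (subset_sums (A \<union> uminus ` A) + K) = K"

lemma aperiodic_half_subgrp: "aperiodic_half K A \<Longrightarrow> subgrp K"
  unfolding aperiodic_half_def by (metis subgrp_period)

lemma aperiodic_half_disjoint:
  "aperiodic_half K A \<Longrightarrow> a \<in> A \<Longrightarrow> a \<notin> K"
  by (auto simp: aperiodic_half_def)

text \<open>Adding the subset sums of the remaining elements preserves every period of the partial
  set, and the full set has only the periods in \<open>K\<close>.\<close>

lemma aperiodic_half_periodic_subset:
  fixes A :: "'a::{ab_group_add,finite} set"
  assumes A: "aperiodic_half K A" and S1: "S1 \<subseteq> A \<union> uminus ` A"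
    and H: "subgrp H" "subset_sums S1 + K + H = subset_sums S1 + K"
  shows "H \<subseteq> K"
proof -
  have "subset_sums (A \<union> uminus ` A) + K = (subset_sums S1 + K) + subset_sums ((A \<union> uminus ` A) - S1)"
    by (simp only: subset_sums_Diff[OF S1] ac_simps)
  then have "period (subset_sums S1 + K) \<subseteq> period (subset_sums (A \<union> uminus ` A) + K)"
    by (simp only: period_plus_mono)
  then have "period (subset_sums S1 + K) \<subseteq> K"
    using A by (simp only: aperiodic_half_def)
  then show ?thesis using H subset_period_iff by blast
qed

lemma subset_sums_symmetric:
  fixes A K :: "'a::{ab_group_add,finite} set"
  assumes "A \<inter> uminus ` A = {}" "subgrp K"
  shows "subset_sums (A \<union> uminus ` A) + K = (subset_sums A + K) + uminus ` (subset_sums A + K)"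
proof -
  have "subset_sums (A \<union> uminus ` A) + K = subset_sums A + uminus ` subset_sums A + (K + K)"
    using assms by (simp add: subset_sums_Un subset_sums_uminus subgrp_plus_self)
  also have "\<dots> = (subset_sums A + K) + uminus ` (subset_sums A + K)"
    by (simp only: uminus_plus uminus_subgrp[OF assms(2)] add.assoc add.left_commute)
  finally show ?thesis .
qed

lemma plus_subgrp_absorb: "subgrp K \<Longrightarrow> X + K + K = X + K"
  by (simp add: add.assoc subgrp_plus_self)

text \<open>This inheritance makes induction on |A| possible. A period obtained from
  \<open>B\<close> is also one for \<open>A\<close>.\<close>

lemma aperiodic_half_subset:
  fixes A :: "'a::{ab_group_add,finite} set"
  assumes A: "aperiodic_half K A" and B: "B \<subseteq> A"
  shows "aperiodic_half K B"
proof -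
  have K: "subgrp K" by (rule aperiodic_half_subgrp[OF A])
  let ?Z = "subset_sums (B \<union> uminus ` B) + K"
  have "period ?Z \<subseteq> K"
  proof (rule aperiodic_half_periodic_subset[OF A])
    show "B \<union> uminus ` B \<subseteq> A \<union> uminus ` A" using B by blast
  qed (rule subgrp_period, rule plus_period)
  moreover have "K \<subseteq> period ?Z"
    unfolding subset_period_iff[OF K] by (rule plus_subgrp_absorb[OF K])
  ultimately have "period ?Z = K" by blast
  moreover have disj: "A \<inter> uminus ` A = {}" "A \<inter> K = {}" using A by (simp_all add: aperiodic_half_def)
  have "B \<inter> uminus ` B = {}" using disj(1) B image_mono[OF B, of uminus] by blast
  moreover have "B \<inter> K = {}" using disj(2) B by blast
  ultimately show ?thesis by (simp add: aperiodic_half_def)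
qed

lemma card_subset_sums_remove:
  fixes A K :: "'a::{ab_group_add,finite} set"
  assumes "a \<in> A"
  shows "card (subset_sums A + K) =
    card (subset_sums (A - {a}) + K) + shift_gain (subset_sums (A - {a}) + K) a"
proof -
  have "subset_sums A + K = (subset_sums (A - {a}) + K) + {0, a}"
    using assms by (simp add: subset_sums_remove[of a A] ac_simps)
  then show ?thesis by (simp only: card_plus_pair)
qed

lemma shift_gain_subset_sums_le:
  fixes A K :: "'a::{ab_group_add,finite} set"
  assumes "a \<in> A"
  shows "card (subset_sums (A - {a}) + K) + shift_gain (subset_sums A + K) a \<le> card (subset_sums A + K)"
proof -
  have "subset_sums A + K = (subset_sums (A - {a}) + K) + {0, a}"
    using assms by (simp add: subset_sums_remove[of a A] ac_simps)
  then have "shift_gain (subset_sums A + K) a \<le> shift_gain (subset_sums (A - {a}) + K) a"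
    by (simp only: shift_gain_plus_pair)
  then show ?thesis using card_subset_sums_remove[OF assms, of K] by simp
qed

lemma card_subgrp_pos: "subgrp K \<Longrightarrow> card K > 0" for K :: "'a::{ab_group_add,finite} set"
  using subgrp_zero by (auto simp: card_gt_0_iff)

text \<open>Periods of \<open>C\<close> are periods of C - C, hence lie in \<open>K\<close>, and
  \<open>a\<close> does not. So \<open>a + C\<close> has a point outside \<open>C\<close>, and with
  it a whole coset of \<open>K\<close>.\<close>

lemma card_aperiodic_half_insert:
  fixes A :: "'a::{ab_group_add,finite} set"
  assumes A: "aperiodic_half K A" and a: "a \<in> A"
  shows "card (subset_sums (A - {a}) + K) + card K \<le> card (subset_sums A + K)"
proof -
  define C where "C = subset_sums (A - {a}) + K"
  have K: "subgrp K" by (rule aperiodic_half_subgrp[OF A])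
  have A': "aperiodic_half K (A - {a})" using A by (rule aperiodic_half_subset) auto
  have CK: "C + K = C" by (simp add: C_def plus_subgrp_absorb[OF K])
  have "period C \<subseteq> period (C + uminus ` C)" by (rule period_plus_mono)
  also have "C + uminus ` C = subset_sums ((A - {a}) \<union> uminus ` (A - {a})) + K"
    using A' K by (simp add: C_def subset_sums_symmetric aperiodic_half_def)
  also have "period \<dots> = K" using A' by (simp add: aperiodic_half_def)
  finally have "a \<notin> period C" using aperiodic_half_disjoint[OF A a] by blast
  then have "({a} + C) - C \<noteq> {}" using periodI[of a C] by blast
  moreover have "(({a} + C) - C) + K = ({a} + C) - C"
  proof (intro equalityI subsetI)
    fix z assume "z \<in> (({a} + C) - C) + K"
    then obtain x g where z: "z = x + g" "g \<in> K" "x - a \<in> C" "x \<notin> C"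
      by (auto simp: mem_singleton_plus elim!: set_plus_elim)
    have "(x - a) + g \<in> C + K" using z by blast
    moreover have "(x + g) + (- g) \<in> C + K" if "x + g \<in> C"
      using that z K by (intro set_plus_intro) (auto intro: subgrp_uminus)
    ultimately show "z \<in> ({a} + C) - C" using z by (auto simp: CK mem_singleton_plus diff_add_eq)
  qed (use subset_plus_right[OF subgrp_zero[OF K]] in blast)
  ultimately have "card K \<le> shift_gain C a"
    unfolding shift_gain_def by (intro card_periodic_ge[OF K])
  then show ?thesis using card_subset_sums_remove[OF a, of K] by (simp add: C_def)
qed

lemma card_aperiodic_half_ge:
  fixes A :: "'a::{ab_group_add,finite} set"
  assumes "aperiodic_half K A"
  shows "card K * (card A + 1) \<le> card (subset_sums A + K)"
  using assms
proof (induction "card A" arbitrary: A)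
  case 0
  have "subset_sums A + K \<supseteq> K"
    using set_zero_plus2[OF zero_in_subset_sums] by blast
  then show ?case using 0 by (simp add: card_mono)
next
  case (Suc n)
  then obtain a where a: "a \<in> A" by fastforce
  have "card K * (card (A - {a}) + 1) \<le> card (subset_sums (A - {a}) + K)"
    using Suc a by (intro Suc.hyps) (auto intro: aperiodic_half_subset)
  then show ?case using card_aperiodic_half_insert[OF Suc.prems a] Suc.hyps(2) a
    by (simp add: algebra_simps)
qed

text \<open>If C = \<Sigma>(A) + K filled more than half of \<open>Q\<close>, the pigeonhole would
  give C - C = Q. Then \<open>Q\<close> would lie in \<open>K\<close>, although it contains the
  nonempty set \<open>A\<close> disjoint from \<open>K\<close>.\<close>

lemma card_aperiodic_half_le:
  fixes A :: "'a::{ab_group_add,finite} set"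
  assumes A: "aperiodic_half K A" and "A \<noteq> {}" and Q: "subgrp Q" "A \<subseteq> Q" "K \<subseteq> Q"
  shows "2 * card (subset_sums A + K) \<le> card Q"
proof (rule ccontr)
  assume *: "\<not> ?thesis"
  define C where "C = subset_sums A + K"
  have K: "subgrp K" by (rule aperiodic_half_subgrp[OF A])
  have "C \<subseteq> Q + Q" unfolding C_def using Q by (intro set_plus_mono2 subset_sums_subgrp)
  then have CQ: "C \<subseteq> Q" using Q by (simp add: subgrp_plus_self)
  have "uminus ` C \<subseteq> uminus ` Q" using CQ by (rule image_mono)
  then have "uminus ` C \<subseteq> Q" using Q by (simp add: uminus_subgrp)
  moreover have "card (uminus ` C) = card C" by (simp add: card_image)
  ultimately have "C + uminus ` C = {0} + Q"
    using Q CQ * by (intro plus_eq_coset) (auto simp: C_def mem_singleton_plus)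
  then have "subset_sums (A \<union> uminus ` A) + K = Q"
    using A K by (simp add: C_def subset_sums_symmetric aperiodic_half_def)
  then have "Q \<subseteq> K"
    using Q by (intro aperiodic_half_periodic_subset[OF A order_refl]) (auto simp: subgrp_plus_self)
  then show False using assms aperiodic_half_disjoint[OF A] by blast
qed

text \<open>Kneser's theorem for \<open>C\<close> and \<open>-C\<close>, whose sum has period
  exactly \<open>K\<close>.\<close>

lemma card_subset_sums_symmetric:
  fixes A :: "'a::{ab_group_add,finite} set"
  assumes A: "aperiodic_half K A"
  shows "2 * card (subset_sums A + K) \<le> card (subset_sums (A \<union> uminus ` A) + K) + card K"
proof -
  define C where "C = subset_sums A + K"
  have K: "subgrp K" by (rule aperiodic_half_subgrp[OF A])
  have Z: "C + uminus ` C = subset_sums (A \<union> uminus ` A) + K"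
    using A K by (simp add: C_def subset_sums_symmetric aperiodic_half_def)
  then have P: "period (C + uminus ` C) = K" using A by (simp add: aperiodic_half_def)
  have "C + K = C" "uminus ` C + K = uminus ` C"
    using K by (simp_all add: C_def uminus_plus uminus_subgrp plus_subgrp_absorb)
  moreover have "C \<noteq> {}" using zero_in_subset_sums subgrp_zero[OF K] by (auto simp: C_def set_plus_def)
  ultimately have "card C + card (uminus ` C) \<le> card (C + uminus ` C) + card K"
    using kneser[of C "uminus ` C"] by (simp add: P)
  moreover have "card (uminus ` C) = card C" by (simp add: card_image)
  ultimately show ?thesis using Z by (simp add: C_def)
qed

text \<open>Changing the signs of the elements of \<open>X\<close> translates the subset sums by
  -\<Sum>X. This freedom is used later to adapt the half to the cosets of a subgroup.\<close>

lemma aperiodic_half_flip: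
  fixes A :: "'a::{ab_group_add,finite} set"
  assumes A: "aperiodic_half K A" and X: "X \<subseteq> A"
  defines "B \<equiv> (A - X) \<union> uminus ` X"
  shows "aperiodic_half K B" "B \<union> uminus ` B = A \<union> uminus ` A" "card B = card A"
    "card (subset_sums B + K) = card (subset_sums A + K)"
proof -
  have K: "subgrp K" by (rule aperiodic_half_subgrp[OF A])
  have uu: "uminus ` uminus ` Y = Y" for Y :: "'a set" by (simp add: image_image)
  have disj: "A \<inter> uminus ` A = {}" using A by (simp add: aperiodic_half_def)
  then have disj': "(A - X) \<inter> uminus ` X = {}" using X by blast
  show S: "B \<union> uminus ` B = A \<union> uminus ` A"
    using X unfolding B_def image_Un uu by blast
  have "B \<inter> uminus ` B = {}"
    using disj X unfolding B_def image_Un uu by (auto simp: image_iff)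
  moreover have "B \<inter> K = {}"
    using A X K by (auto simp: B_def aperiodic_half_def subgrp_uminus_iff)
  ultimately show "aperiodic_half K B"
    using A S by (simp add: aperiodic_half_def)
  have "card (uminus ` X) = card X" by (simp add: card_image)
  then show "card B = card A"
    using X disj' by (simp add: B_def card_Un_disjoint card_Diff_subset card_mono)
  have "subset_sums B + K = {- \<Sum>X} + ((subset_sums X + subset_sums (A - X)) + K)"
    by (simp add: B_def subset_sums_Un[OF disj'] subset_sums_uminus_shift ac_simps)
  also have "subset_sums X + subset_sums (A - X) = subset_sums A"
    using subset_sums_Diff[OF X] by simp
  finally show "card (subset_sums B + K) = card (subset_sums A + K)" by simp
qed

text \<open>Numerical end of the case without tight subgroups: \<open>m\<close>, \<open>k\<close>,
  \<open>c\<close> are |A|, |K|, |\<Sigma>(A) + K| and \<open>L\<close> bounds the gains. Olson's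
  inequality with growth 2m asserts the opposite.\<close>

lemma olson_bound_strict:
  fixes m k c L :: real
  assumes m: "m \<ge> 3" and k: "k \<ge> 1" and L: "0 \<le> L" "L \<le> m - 2"
    and c: "c = (m - 1) * (m - 2) / 2 + k + 2 + L"
  shows "L * (2 * c - k + m)\<^sup>2 < 4 * m * c\<^sup>2"
proof -
  have mm: "0 \<le> (m - 1) * (m - 2)" using m by simp
  have cpos: "c \<ge> k + 2" using c mm L by simp
  show ?thesis
  proof (cases "m \<le> k")
    case True
    have "(2 * c - k + m)\<^sup>2 \<le> (2 * c)\<^sup>2" using True cpos m by (intro power_mono) auto
    then have "L * (2 * c - k + m)\<^sup>2 \<le> L * (2 * c)\<^sup>2" using L by (intro mult_left_mono)
    also have "\<dots> \<le> (m - 2) * (2 * c)\<^sup>2" using L by (intro mult_right_mono) auto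
    also have "\<dots> < m * (2 * c)\<^sup>2" using cpos k by (intro mult_strict_right_mono) auto
    finally show ?thesis by (simp add: power2_eq_square)
  next
    case False
    \<comment> \<open>After subtraction of 4Lc^2 the claim compares L(4cw + w^2) with 4c^2(m -
      L).\<close>
    define w where "w = m - k"
    have w: "0 < w" "w \<le> m - 1" using False k by (auto simp: w_def)
    \<comment> \<open>Expanding the nonnegative product \<open>p\<close> bounds
      \<open>c * (m - L)\<close> below by an expression in which \<open>L\<close> has
      cancelled.\<close>
    define p where "p = (m - 2 - L) * (c - 2)"
    have p: "0 \<le> p" unfolding p_def using L cpos k by (intro mult_nonneg_nonneg) auto
    have "c * (m - L) = 2 * c + p + 2 * (m - 2 - L)" by (simp add: p_def algebra_simps)
    moreover have "2 * c = m * m - 3 * m + 2 + 2 * k + 4 + 2 * L" unfolding c by (simp add: field_simps)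
    ultimately have 1: "c * (m - L) \<ge> m * m - m + 2 * k + 2" using p by simp
    have 2: "L * w \<le> (m - 2) * (m - 1)" using L w m by (intro mult_mono) auto
    have 3: "L * w * w \<le> (m - 2) * (m - 1) * (m - 1)"
      using mult_mono[OF 2 w(2)] w m by simp
    have a1: "4 * c * (L * w) \<le> 4 * c * ((m - 2) * (m - 1))"
      by (rule mult_left_mono[OF 2]) (use cpos k in simp)
    have a2: "4 * c * (m * m - m + 4) \<le> 4 * c * (c * (m - L))"
    proof (rule mult_left_mono)
      show "m * m - m + 4 \<le> c * (m - L)" using 1 k by linarith
    qed (use cpos k in simp)
    have a3: "(m - 2) * (m - 1) * (m - 1) < 4 * c * (2 * m + 2)"
    proof -
      have "(m - 2) * (m - 1) \<le> 2 * c" using c k L by (simp add: mult.commute)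
      then have "(m - 2) * (m - 1) * (m - 1) \<le> 2 * c * (m - 1)" by (rule mult_right_mono) (use m in simp)
      also have "\<dots> < 2 * c * (2 * (2 * m + 2))"
        by (rule mult_strict_left_mono) (use m cpos k in auto)
      also have "\<dots> = 4 * c * (2 * m + 2)" by (simp add: algebra_simps)
      finally show ?thesis .
    qed
    have a4: "4 * c * ((m - 2) * (m - 1)) + 4 * c * (2 * m + 2) = 4 * c * (m * m - m + 4)"
      by (simp add: algebra_simps)
    have lin: "x + l < u" if "x \<le> y" "z \<le> u" "v < n" "y + n = z" "l \<le> v" for x l u y z v n :: real
      using that by linarith
    have k1: "4 * c * (L * w) + L * w * w < 4 * c * (c * (m - L))"
      by (rule lin[OF a1 a2 a3 a4 3])
    have k2: "L * (2 * c - k + m)\<^sup>2 = 4 * c * (L * w) + L * w * w + 4 * L * c\<^sup>2"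
      by (simp add: w_def power2_eq_square algebra_simps)
    have k3: "4 * m * c\<^sup>2 = 4 * c * (c * (m - L)) + 4 * L * c\<^sup>2"
      by (simp add: power2_eq_square algebra_simps)
    show ?thesis unfolding k2 k3 using k1 by (rule add_strict_right_mono)
  qed
qed

section \<open>Removing elements of an almost full coset\<close>

text \<open>Remove \<open>x\<close> and \<open>f x\<close> together and recurse. The involution will
  be negation, once on group elements and once on cosets.\<close>

lemma involution_transversal:
  assumes "finite X" "\<And>x. x \<in> X \<Longrightarrow> f x \<in> X" "\<And>x. x \<in> X \<Longrightarrow> f (f x) = x" "\<And>x. x \<in> X \<Longrightarrow> f x \<noteq> x"
  shows "\<exists>Y. Y \<union> f ` Y = X \<and> Y \<inter> f ` Y = {}"
  using assms
proof (induction "card X" arbitrary: X rule: less_induct)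
  case less
  show ?case
  proof (cases "X = {}")
    case False
    then obtain x where x: "x \<in> X" by blast
    define X' where "X' = X - {x, f x}"
    have inv: "f y \<noteq> x" "f y \<noteq> f x" if "y \<in> X'" for y
      using that less.prems x unfolding X'_def by (metis DiffE insertI1 insertI2)+
    have "card X' < card X" unfolding X'_def using x less.prems(1) by (intro psubset_card_mono) auto
    moreover have "f y \<in> X'" if "y \<in> X'" for y using that inv[OF that] less.prems(2)[of y] by (auto simp: X'_def)
    ultimately have "\<exists>Y. Y \<union> f ` Y = X' \<and> Y \<inter> f ` Y = {}"
      using less.prems by (intro less.hyps) (auto simp: X'_def)
    then obtain Y where Y: "Y \<union> f ` Y = X'" "Y \<inter> f ` Y = {}" by blast
    have "insert x Y \<union> f ` insert x Y = X' \<union> {x, f x}" using Y(1) by auto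
    also have "\<dots> = X" using x less.prems(2) by (auto simp: X'_def)
    finally have "insert x Y \<union> f ` insert x Y = X" .
    moreover have "x \<notin> X'" "f x \<notin> X'" by (auto simp: X'_def)
    then have "insert x Y \<inter> f ` insert x Y = {}"
      using Y less.prems(4)[OF x] by auto
    ultimately show ?thesis by blast
  qed auto
qed

text \<open>
  Walking back from an exit point \<open>z\<close> of \<open>D\<close> in steps of \<open>y\<close>, one enters \<open>C\<close> before leaving \<open>D\<close>;
  the last point before entering is gained by \<open>C\<close>, and it determines \<open>z\<close>.
\<close>

lemma shift_gain_le_fill:
  fixes C D :: "'a::{ab_group_add,finite} set" and y :: 'a
  defines "mul \<equiv> \<lambda>t :: nat. \<Sum>i<t. y"
  assumes CD: "C \<subseteq> D"
    and fill: "\<And>z. z \<in> ({y} + D) - D \<Longrightarrow>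
      \<exists>t\<ge>1. z - mul t \<in> C \<and> (\<forall>s. 1 \<le> s \<and> s \<le> t \<longrightarrow> z - mul s \<in> D)"
  shows "shift_gain D y \<le> shift_gain C y"
proof -
  have mul_add: "mul (a + b) = mul a + mul b" for a b
    by (induction b) (simp_all add: mul_def ac_simps)
  have mul_1: "mul 1 = y" by (simp add: mul_def)
  define S where "S = ({y} + D) - D"
  \<comment> \<open>\<open>Suc t\<close> is the first step at which the walk is in \<open>C\<close>.
    For \<open>t = 0\<close> the point before it is \<open>z\<close> itself, which is outside
    \<open>D\<close> and so outside \<open>C\<close>.\<close>
  have "\<exists>t. z - mul (Suc t) \<in> C \<and> z - mul t \<notin> C \<and> (\<forall>s. 1 \<le> s \<and> s \<le> t \<longrightarrow> z - mul s \<in> D)"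
    if z: "z \<in> S" for z
  proof -
    obtain t where t: "t \<ge> 1" "z - mul t \<in> C" "\<And>s. 1 \<le> s \<Longrightarrow> s \<le> t \<Longrightarrow> z - mul s \<in> D"
      using fill[of z] z unfolding S_def by blast
    define P where "P t \<longleftrightarrow> t \<ge> 1 \<and> z - mul t \<in> C" for t
    have "P t" using t by (simp add: P_def)
    define u where "u = (LEAST t. P t)"
    have "P u" "u \<le> t" "\<And>s. s < u \<Longrightarrow> \<not> P s"
      using \<open>P t\<close> by (auto simp: u_def intro: LeastI Least_le dest: not_less_Least)
    then obtain v where v: "u = Suc v" by (cases u) (auto simp: P_def)
    have "z - mul v \<notin> C"
    proof (cases v)
      case 0
      then show ?thesis using z CD by (auto simp: S_def mul_def)
    next
      case (Suc w)
      then show ?thesis using \<open>\<And>s. s < u \<Longrightarrow> \<not> P s\<close>[of v] v by (simp add: P_def)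
    qed
    then show ?thesis using \<open>P u\<close> \<open>u \<le> t\<close> t(3) v by (intro exI[of _ v]) (auto simp: P_def)
  qed
  then obtain \<tau> where \<tau>: "\<And>z. z \<in> S \<Longrightarrow> z - mul (Suc (\<tau> z)) \<in> C \<and> z - mul (\<tau> z) \<notin> C \<and>
      (\<forall>s. 1 \<le> s \<and> s \<le> \<tau> z \<longrightarrow> z - mul s \<in> D)"
    by metis
  define w where "w z = z - mul (\<tau> z)" for z
  \<comment> \<open>If walks of different lengths ended in the same point, the longer one would pass
    through the start of the shorter one, which is outside \<open>D\<close>.\<close>
  have le: "\<tau> z' \<le> \<tau> z" if "z \<in> S" "z' \<in> S" "w z = w z'" for z z'
  proof (rule ccontr)
    assume n: "\<not> \<tau> z' \<le> \<tau> z"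
    define s where "s = \<tau> z' - \<tau> z"
    have "mul (\<tau> z') = mul (\<tau> z) + mul s" using n mul_add[of "\<tau> z" s] by (simp add: s_def)
    then have "z' - mul s = z" using that(3) by (simp add: w_def algebra_simps)
    moreover have "z' - mul s \<in> D" using \<tau>[OF that(2)] n by (auto simp: s_def)
    ultimately show False using that(1) by (simp add: S_def)
  qed
  have "inj_on w S"
  proof (rule inj_onI)
    fix z z' assume z: "z \<in> S" "z' \<in> S" "w z = w z'"
    then have "\<tau> z = \<tau> z'" using le[of z z'] le[of z' z] by simp
    then show "z = z'" using z by (simp add: w_def)
  qed
  moreover have "w ` S \<subseteq> ({y} + C) - C"
  proof
    fix a assume "a \<in> w ` S"
    then obtain z where z: "z \<in> S" "a = w z" by blast
    have "w z - y = z - mul (Suc (\<tau> z))"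
      by (simp add: w_def mul_def algebra_simps)
    then have "w z - y \<in> C" using \<tau>[OF z(1)] by (simp only:)
    then show "a \<in> ({y} + C) - C" using \<tau>[OF z(1)] z(2) by (simp add: mem_singleton_plus w_def)
  qed
  ultimately have "card S \<le> card (({y} + C) - C)" by (intro card_inj_on_le) auto
  then show ?thesis by (simp add: S_def shift_gain_def)
qed

text \<open>The set W + \<Sigma>(Y) + H is the union of the layers W + H + jy for j \<le> |Y|. A
  point gained in direction \<open>y\<close> comes from the last layer, so walking back |Y| steps
  leads through the layers into W + y + H, which lies in \<open>C\<close>.\<close>

lemma shift_gain_coset_fill:
  fixes C W Y H :: "'a::{ab_group_add,finite} set"
  assumes H: "subgrp H" and Y: "Y \<subseteq> {y} + H" "Y \<noteq> {}"
    and C: "C \<subseteq> W + subset_sums Y + H" "W + ({y} + H) \<subseteq> C"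
  shows "shift_gain (W + subset_sums Y + H) y \<le> shift_gain C y"
proof (rule shift_gain_le_fill[OF C(1)])
  define mul where "mul t = (\<Sum>i<t. y)" for t :: nat
  define WH where "WH = W + H"
  have mul_add: "mul (a + b) = mul a + mul b" for a b
    by (induction b) (simp_all add: mul_def ac_simps)
  have WH: "z - h \<in> WH \<longleftrightarrow> z \<in> WH" if "h \<in> H" for z h
  proof -
    have "{h} + H = H" using subgrp_plus_absorb[OF H, of "{h}"] that by simp
    then have "{h} + WH = WH" unfolding WH_def by (metis add.left_commute)
    then show ?thesis by (metis mem_singleton_plus)
  qed
  \<comment> \<open>All elements of \<open>X\<close> agree with \<open>y\<close> modulo
    \<open>H\<close>, so only the number of summands counts.\<close>
  have mem: "z \<in> WH + subset_sums X \<longleftrightarrow> (\<exists>j\<le>card X. z - mul j \<in> WH)" if "X \<subseteq> Y" for X z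
  proof -
    have "finite X" by simp
    from this that show ?thesis
    proof (induction X arbitrary: z rule: finite_induct)
      case empty
      have "WH + {0} = WH" using add_0_right[of WH] by (simp add: set_zero)
      then show ?case by (simp add: mul_def)
    next
      case (insert r X)
      have "r - y \<in> H" using insert.prems Y by (auto simp: mem_singleton_plus)
      moreover have "z - r - mul j = (z - mul (Suc j)) - (r - y)" for j
        by (simp add: mul_def algebra_simps)
      ultimately have r: "z - r - mul j \<in> WH \<longleftrightarrow> z - mul (Suc j) \<in> WH" for j
        by (simp only: WH)
      have "WH + subset_sums (insert r X) = (WH + subset_sums X) + {0, r}"
        using insert.hyps by (simp add: subset_sums_remove[of r "insert r X"] ac_simps)
      then have "z \<in> WH + subset_sums (insert r X) \<longleftrightarrow>
          z \<in> WH + subset_sums X \<or> z - r \<in> WH + subset_sums X"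
        by (simp only: plus_pair Un_iff mem_singleton_plus)
      also have "\<dots> \<longleftrightarrow> (\<exists>j\<le>card X. z - mul j \<in> WH) \<or> (\<exists>j\<le>card X. z - mul (Suc j) \<in> WH)"
        using insert.IH insert.prems r by simp
      also have "\<dots> \<longleftrightarrow> (\<exists>j\<le>Suc (card X). z - mul j \<in> WH)"
      proof (intro iffI; elim disjE exE conjE)
        fix j assume j: "j \<le> Suc (card X)" "z - mul j \<in> WH"
        show "(\<exists>j\<le>card X. z - mul j \<in> WH) \<or> (\<exists>j\<le>card X. z - mul (Suc j) \<in> WH)"
          using j by (cases j) auto
      qed (auto intro: le_SucI)
      finally show ?case using insert.hyps by simp
    qed
  qed
  fix z assume "z \<in> ({y} + (W + subset_sums Y + H)) - (W + subset_sums Y + H)"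
  moreover have D: "W + subset_sums Y + H = WH + subset_sums Y" by (simp add: WH_def ac_simps)
  ultimately have z: "z - y \<in> WH + subset_sums Y" "z \<notin> WH + subset_sums Y"
    by (simp_all add: mem_singleton_plus)
  define n where "n = card Y"
  have n: "n \<ge> 1" using Y(2) by (simp add: n_def Suc_le_eq card_gt_0_iff)
  obtain j where j: "j \<le> n" "z - y - mul j \<in> WH" using z(1) mem[of Y] by (auto simp: n_def)
  have "z - y - mul j = z - mul (Suc j)" by (simp add: mul_def algebra_simps)
  \<comment> \<open>For \<open>j < n\<close> the point \<open>z\<close> would lie in layer
    \<open>Suc j\<close>.\<close>
  then have jn: "j = n" using z(2) mem[of Y] j by (metis Suc_leI le_neq_implies_less n_def order_refl)
  then have zn: "z - mul (Suc n) \<in> WH" using j(2) \<open>z - y - mul j = z - mul (Suc j)\<close> by (simp only:)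
  have zs: "z - mul s \<in> WH + subset_sums Y" if "1 \<le> s" "s \<le> n" for s
  proof -
    have "z - mul s - mul (Suc n - s) = z - mul (Suc n)"
      using mul_add[of s "Suc n - s"] that by (simp add: algebra_simps)
    then have "z - mul s - mul (Suc n - s) \<in> WH" using zn by (simp only:)
    moreover have "Suc n - s \<le> card Y" using that by (simp add: n_def)
    ultimately show ?thesis using mem[of Y "z - mul s"] by blast
  qed
  have zC: "z - mul n \<in> C"
  proof -
    have "z - mul n - y = z - mul (Suc n)" by (simp add: mul_def algebra_simps)
    then have "z - mul n \<in> {y} + WH" using zn by (simp only: mem_singleton_plus)
    also have "{y} + WH = W + ({y} + H)" by (simp only: WH_def ac_simps)
    finally show ?thesis using C(2) by blast
  qed
  have "1 \<le> n \<and> z - mul n \<in> C \<and> (\<forall>s. 1 \<le> s \<and> s \<le> n \<longrightarrow> z - mul s \<in> WH + subset_sums Y)"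
    using n zC zs by simp
  then have "\<exists>t\<ge>1. z - mul t \<in> C \<and> (\<forall>s. 1 \<le> s \<and> s \<le> t \<longrightarrow> z - mul s \<in> WH + subset_sums Y)"
    by (rule exI)
  then show "\<exists>t::nat\<ge>1. z - (\<Sum>i<t. y) \<in> C \<and>
      (\<forall>s. 1 \<le> s \<and> s \<le> t \<longrightarrow> z - (\<Sum>i<s. y) \<in> W + subset_sums Y + H)"
    unfolding D mul_def .
qed

lemma shift_gain_coset_cong:
  assumes H: "subgrp H" and D: "D + H = D" and r: "r \<in> {x} + H"
  shows "shift_gain D r = shift_gain D x"
proof -
  have "{r} + H = {x} + H"
    using coset_eqI[OF H, of r x] r subgrp_zero[OF H]
    by (metis IntI add.right_neutral empty_iff mem_singleton_plus cancel_comm_monoid_add_class.diff_cancel)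
  then have "{r} + D = {x} + D" using D by (metis add.assoc add.commute)
  then show ?thesis by (simp add: shift_gain_def)
qed

text \<open>Modulo \<open>H\<close> all elements of \<open>R\<close> are the one direction
  \<open>x\<close>, and adjoining a summand never raises the gain in its own direction.\<close>

lemma shift_gain_remove_coset:
  fixes A H R :: "'a::{ab_group_add,finite} set"
  assumes H: "subgrp H" and R: "R \<subseteq> A" "R \<subseteq> {x} + H"
  shows "shift_gain (subset_sums A + H) x \<le> shift_gain (subset_sums (A - R) + H) x"
proof -
  have "finite R" by simp
  from this R show ?thesis
  proof (induction R rule: finite_induct)
    case (insert r R)
    define D where "D = subset_sums (A - insert r R) + H"
    have r: "r \<in> A - R" "(A - R) - {r} = A - insert r R" using insert by auto
    have "subset_sums (A - R) + H = D + {0, r}"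
      using subset_sums_remove[OF r(1)] unfolding r(2) D_def by (simp add: ac_simps)
    then have "shift_gain (subset_sums (A - R) + H) r \<le> shift_gain D r"
      by (simp only: shift_gain_plus_pair)
    moreover have "shift_gain (subset_sums (A - R) + H) r = shift_gain (subset_sums (A - R) + H) x"
        "shift_gain D r = shift_gain D x"
      using insert.prems by (auto intro!: shift_gain_coset_cong[OF H] simp: D_def plus_subgrp_absorb[OF H])
    ultimately show ?case using insert by (simp add: D_def)
  qed simp
qed

text \<open>Remove the elements of \<open>R\<close> one at a time. While the rest of
  \<open>Q\<close> fills the coset together with \<open>CH\<close>, the gain of the current set
  \<open>C\<close> is at least that of C + H, which the earlier removals have not lowered below
  \<delta>.\<close>

lemma card_subset_sums_remove_coset:
  fixes A H K :: "'a::{ab_group_add,finite} set"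
  assumes H: "subgrp H" and K: "subgrp K" "K \<subseteq> H"
    and Q: "Q \<subseteq> A" "Q \<subseteq> {x} + H" "x \<notin> H"
    and gain: "\<delta> \<le> shift_gain (subset_sums A + H) x"
    and R: "R \<subseteq> Q" "card R < card Q"
    and full: "card H + card R < card Q + card (subset_sums (A \<inter> H) + K)"
  shows "card (subset_sums (A - R) + K) + \<delta> * card R \<le> card (subset_sums A + K)"
proof -
  define CH where "CH = subset_sums (A \<inter> H) + K"
  have "CH \<subseteq> H + H" unfolding CH_def using H K by (intro set_plus_mono2 subset_sums_subgrp) auto
  then have CH: "CH \<subseteq> H" by (simp add: subgrp_plus_self[OF H])
  have CH0: "0 \<in> CH" unfolding CH_def using set_plus_intro[OF zero_in_subset_sums subgrp_zero[OF K(1)]] by simp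
  have QH: "Q \<inter> H = {}"
  proof -
    have "x \<in> H" if "z \<in> Q" "z \<in> H" for z
    proof -
      have "z - x \<in> H" using that(1) Q(2) mem_singleton_plus by blast
      then show "x \<in> H" using subgrp_diff[OF H that(2)] by force
    qed
    then show ?thesis using Q(3) by blast
  qed
  have "finite R" by simp
  from this R full show ?thesis
  proof (induction R rule: finite_induct)
    case (insert r R)
    define Y where "Y = Q - insert r R"
    define W where "W = subset_sums (A - Q - H)"
    define C where "C = subset_sums (A - insert r R) + K"
    have cY: "card Y = card Q - card (insert r R)" "card (insert r R) < card Q"
      using insert.prems by (simp_all only: Y_def card_Diff_subset finite_code)
    have "A - insert r R = (A - Q - H) \<union> (Y \<union> (A \<inter> H))"
      using Q QH insert.prems by (auto simp: Y_def)
    moreover have "(A - Q - H) \<inter> (Y \<union> (A \<inter> H)) = {}" "Y \<inter> (A \<inter> H) = {}"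
      using QH by (auto simp: Y_def)
    ultimately have "subset_sums (A - insert r R) = W + (subset_sums Y + subset_sums (A \<inter> H))"
      by (simp only: W_def subset_sums_Un)
    then have C: "C = W + subset_sums Y + CH"
      by (simp only: C_def CH_def add.assoc)
    have "C + H = W + subset_sums Y + (CH + H)" by (simp add: C ac_simps)
    also have "CH + H = H" using CH0 CH by (intro subgrp_plus_absorb[OF H]) auto
    finally have CHH: "C + H = W + subset_sums Y + H" .
    have Yx: "Y \<subseteq> {x} + H" using Q by (auto simp: Y_def)
    have rx: "r \<in> {x} + H" using Q insert.prems by auto
    have coset: "{r} + H = {x} + H"
      using coset_eqI[OF H, of r x] rx subgrp_zero[OF H]
      by (metis IntI diff_self empty_iff mem_singleton_plus)
    \<comment> \<open>For \<open>insert r R\<close>, the hypothesis \<open>full\<close> says |Y| +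
      |CH| > |H|, as the pigeonhole requires.\<close>
    have "Y + CH = {x} + H"
      using insert.prems cY unfolding CH_def[symmetric] by (intro plus_eq_coset[OF H Yx CH]) linarith
    then have "W + ({r} + H) = W + (Y + CH)" by (simp add: coset)
    also have "\<dots> \<subseteq> W + (subset_sums Y + CH)" by (intro set_plus_mono2 subset_subset_sums) auto
    finally have "W + ({r} + H) \<subseteq> C" by (simp add: C ac_simps)
    moreover have "C \<subseteq> C + H" by (rule subset_plus_right[OF subgrp_zero[OF H]])
    moreover have "Y \<noteq> {}" using cY by auto
    ultimately have "shift_gain (C + H) r \<le> shift_gain C r"
      using Yx coset unfolding CHH by (intro shift_gain_coset_fill[OF H]) auto
    moreover have "shift_gain (C + H) r = shift_gain (C + H) x"
      by (rule shift_gain_coset_cong[OF H plus_subgrp_absorb[OF H] rx])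
    moreover have "C + H = subset_sums (A - insert r R) + H"
    proof -
      have "K + H = H" using K subgrp_zero[OF K(1)] by (intro subgrp_plus_absorb[OF H]) auto
      then show ?thesis by (simp add: C_def add.assoc)
    qed
    moreover have "shift_gain (subset_sums A + H) x \<le> shift_gain (subset_sums (A - insert r R) + H) x"
      using insert.prems Q by (intro shift_gain_remove_coset[OF H]) auto
    ultimately have "\<delta> \<le> shift_gain C r" using gain by simp
    moreover have "r \<in> A - R" "(A - R) - {r} = A - insert r R" using insert Q by auto
    then have "card (subset_sums (A - R) + K) = card C + shift_gain C r"
      using card_subset_sums_remove[of r "A - R" K] by (simp add: C_def)
    moreover have "card (subset_sums (A - R) + K) + \<delta> * card R \<le> card (subset_sums A + K)"
      using insert by auto
    ultimately show ?case using insert.hyps by (simp add: C_def)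
  qed simp
qed

section \<open>Subgroups obstructing the growth\<close>

text \<open>The summand 4 is more than the theorem requires, but it makes \<open>2|A| \<le> |\<Sigma>(A) + K|\<close> true for all \<open>A \<noteq> {}\<close>.\<close>

definition large :: "'a::ab_group_add set \<Rightarrow> 'a set \<Rightarrow> bool" where
  "large K A \<longleftrightarrow> card A * (card A - 1) + 2 * card K + 4 \<le> 2 * card (subset_sums A + K)"

text \<open>
  If no subgroup is tight, Kneser's theorem makes the iterated sumsets grow by \<open>2|A|\<close> in each step.
\<close>

definition tight_subgrp :: "'a::ab_group_add set \<Rightarrow> 'a set \<Rightarrow> 'a set \<Rightarrow> bool" where
  "tight_subgrp K A H \<longleftrightarrow> subgrp H \<and> K \<subseteq> H \<and> \<not> A \<subseteq> H \<and>
     card (insert 0 (A \<union> uminus ` A) + H) < 2 * card A + card H"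

lemma card_symmetrization:
  "A \<inter> uminus ` A = {} \<Longrightarrow> card (A \<union> uminus ` A) = 2 * card A"
  for A :: "'a::{ab_group_add,finite} set"
  by (simp add: card_Un_disjoint card_image)

lemma symmetrization_Int_subgrp:
  "subgrp H \<Longrightarrow> (A \<union> uminus ` A) \<inter> H = (A \<inter> H) \<union> uminus ` (A \<inter> H)"
  by (auto simp: subgrp_uminus_iff intro: subgrp_uminus)

text \<open>The bounds feed the pigeonhole arguments for A \<inter> H below. The first comes from
  counting cosets of \<open>K\<close> if \<open>A\<close> is a singleton and from
  \<open>large\<close> otherwise.\<close>

lemma twice_card_le:
  fixes A :: "'a::{ab_group_add,finite} set"
  assumes A: "aperiodic_half K A" "A \<noteq> {}" and large: "2 \<le> card A \<Longrightarrow> large K A"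
  shows "2 * card A \<le> card (subset_sums A + K)" "2 * card K \<le> card (subset_sums A + K)"
proof -
  have K: "card K > 0" by (rule card_subgrp_pos[OF aperiodic_half_subgrp[OF A(1)]])
  have A0: "card A \<ge> 1" using A(2) by (simp add: Suc_le_eq card_gt_0_iff)
  have ge: "card K * (card A + 1) \<le> card (subset_sums A + K)" by (rule card_aperiodic_half_ge[OF A(1)])
  have "card K * 2 \<le> card K * (card A + 1)" using A0 by (intro mult_le_mono2) simp
  then have "card K * 2 \<le> card (subset_sums A + K)" using ge by (rule order_trans)
  then show "2 * card K \<le> card (subset_sums A + K)" by (simp add: mult.commute)
  show "2 * card A \<le> card (subset_sums A + K)"
  proof (cases "card A = 1")
    case True
    then show ?thesis using ge K by simp
  next
    case False
    then obtain n where n: "card A = n + 2" using A0 by (intro that[of "card A - 2"]) simp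
    \<comment> \<open>Equality holds for \<open>card A = 2\<close> and \<open>card A = 3\<close>.
      The 6 is the summand 4 of \<open>large\<close> together with
      \<open>2 * card K \<ge> 2\<close>.\<close>
    have "4 * card A \<le> card A * (card A - 1) + 6"
    proof -
      consider "n = 0" | "n = 1" | l where "n = l + 2"
        using that by (metis One_nat_def add_2_eq_Suc' old.nat.exhaust)
      then show ?thesis
        by cases (auto simp: n algebra_simps)
    qed
    moreover have "large K A" using large n by simp
    ultimately show ?thesis using K by (simp add: large_def)
  qed
qed

section \<open>Structure of a tight subgroup\<close>

text \<open>\<open>Ob\<close> collects the holes, the elements that \<open>S\<close> misses in the
  cosets other than \<open>H\<close> that it meets. Splitting S + H into H, S - H and the holes
  turns tightness into |Ob| < 2|A \<inter> H|. The bounds for \<open>CH\<close> hold because A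
  \<inter> H is a proper subset of \<open>A\<close>.\<close>

lemma tight_subgrp_facts:
  fixes A K H :: "'a::{ab_group_add,finite} set"
  assumes A: "aperiodic_half K A" and H: "tight_subgrp K A H"
    and large: "\<forall>B. B \<subset> A \<longrightarrow> 2 \<le> card B \<longrightarrow> large K B"
  defines "S \<equiv> A \<union> uminus ` A"
  defines "Ob \<equiv> (insert 0 S + H) - H - S"
  defines "CH \<equiv> subset_sums (A \<inter> H) + K"
  shows "K \<noteq> H" "card (insert 0 S + H) + 2 * card (A \<inter> H) = card H + 2 * card A + card Ob"
    "card Ob < 2 * card (A \<inter> H)" "2 * card (A \<inter> H) \<le> card CH" "2 * card K \<le> card CH" "2 * card CH \<le> card H"
    "A \<inter> H \<noteq> {}"
proof -
  have K: "subgrp K" by (rule aperiodic_half_subgrp[OF A])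
  have sH: "subgrp H" and KH: "K \<subseteq> H" and AH: "\<not> A \<subseteq> H"
    and lt: "card (insert 0 S + H) < 2 * card A + card H"
    using H by (auto simp: tight_subgrp_def S_def)
  have disj: "A \<inter> uminus ` A = {}" "A \<inter> K = {}" using A by (simp_all add: aperiodic_half_def)
  have cS: "card S = 2 * card A" using disj by (simp add: S_def card_symmetrization)
  have HS: "H \<subseteq> insert 0 S + H" using set_zero_plus2[of "insert 0 S" H] by simp
  have SS: "S \<subseteq> insert 0 S + H" using subset_plus_right[OF subgrp_zero[OF sH], of "insert 0 S"] by blast
  have un: "insert 0 S + H = (S - H) \<union> (H \<union> Ob)" using HS SS by (auto simp: Ob_def)
  have "card ((S - H) \<union> (H \<union> Ob)) = card (S - H) + card (H \<union> Ob)"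
    by (intro card_Un_disjoint) (auto simp: Ob_def)
  moreover have "card (H \<union> Ob) = card H + card Ob"
    by (intro card_Un_disjoint) (auto simp: Ob_def)
  ultimately have c: "card (insert 0 S + H) = card (S - H) + card H + card Ob" by (simp add: un)
  have "card (S \<inter> H) = 2 * card (A \<inter> H)"
  proof -
    have "(A \<inter> H) \<inter> uminus ` (A \<inter> H) = {}" using disj(1) by blast
    then show ?thesis unfolding S_def symmetrization_Int_subgrp[OF sH] by (rule card_symmetrization)
  qed
  then have cSH: "card (S - H) + 2 * card (A \<inter> H) = 2 * card A"
    using card_Diff_subset_Int[of S H] card_mono[of S "S \<inter> H"] cS by simp
  show eq: "card (insert 0 S + H) + 2 * card (A \<inter> H) = card H + 2 * card A + card Ob"
    using c cSH by simp
  then show cO: "card Ob < 2 * card (A \<inter> H)" using lt by simp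
  then show ne: "A \<inter> H \<noteq> {}" by auto
  then show "K \<noteq> H" using disj by blast
  have AH': "A \<inter> H \<subset> A" using AH by blast
  have ap: "aperiodic_half K (A \<inter> H)" using A by (rule aperiodic_half_subset) simp
  show "2 * card (A \<inter> H) \<le> card CH" "2 * card K \<le> card CH"
    using twice_card_le[OF ap ne] large AH' by (simp_all add: CH_def)
  show "2 * card CH \<le> card H"
    unfolding CH_def using KH by (intro card_aperiodic_half_le[OF ap ne sH]) auto
qed

text \<open>Otherwise H \<union> (y + H) is a subgroup \<open>H2\<close>. Since there are few holes,
  the subset sums of S \<inter> H2 fill both cosets, so \<open>H2\<close> consists of periods and
  lies in \<open>K\<close>, although \<open>K\<close> is properly contained in
  \<open>H\<close>.\<close>

lemma tight_subgrp_no_involution: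
  fixes A K H :: "'a::{ab_group_add,finite} set"
  assumes A: "aperiodic_half K A" and H: "tight_subgrp K A H"
    and large: "\<forall>B. B \<subset> A \<longrightarrow> 2 \<le> card B \<longrightarrow> large K B"
    and y: "y \<in> A \<union> uminus ` A" "y \<notin> H"
  shows "y + y \<notin> H"
proof
  assume yy: "y + y \<in> H"
  define S where "S = A \<union> uminus ` A"
  define Ob where "Ob = (insert 0 S + H) - H - S"
  define CH where "CH = subset_sums (A \<inter> H) + K"
  note facts = tight_subgrp_facts[OF A H large, folded S_def, folded Ob_def CH_def]
  have K: "subgrp K" by (rule aperiodic_half_subgrp[OF A])
  have sH: "subgrp H" and KH: "K \<subseteq> H" using H by (auto simp: tight_subgrp_def)
  have ap: "aperiodic_half K (A \<inter> H)" using A by (rule aperiodic_half_subset) simp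
  define EH where "EH = subset_sums (S \<inter> H) + K"
  have "2 * card CH \<le> card EH + card K"
    using card_subset_sums_symmetric[OF ap]
    unfolding EH_def S_def symmetrization_Int_subgrp[OF sH] CH_def .
  \<comment> \<open>Kneser's theorem gives |EH| \<ge> 2|CH| - |K|. The surplus 1 pays for
    withholding \<open>y\<close> from \<open>Q\<close>.\<close>
  then have EHcard: "2 * card (A \<inter> H) + 1 \<le> card EH"
    using facts(4,5) card_subgrp_pos[OF K] by linarith
  have "EH \<subseteq> H + H" unfolding EH_def using KH by (intro set_plus_mono2 subset_sums_subgrp[OF sH]) auto
  then have EHsub: "EH \<subseteq> H" by (simp add: subgrp_plus_self[OF sH])
  define Q where "Q = S \<inter> ({y} + H)"
  have yH: "({y} + H) \<inter> H = {}"
  proof -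
    have "y \<in> H" if "z - y \<in> H" "z \<in> H" for z using subgrp_diff[OF sH that(2,1)] by simp
    then show ?thesis using y(2) by (auto simp: mem_singleton_plus)
  qed
  have "{y} + H \<subseteq> insert 0 S + H" using y by (intro set_plus_mono2) (auto simp: S_def)
  then have "({y} + H) - S \<subseteq> Ob" using yH by (auto simp: Ob_def)
  then have "card (({y} + H) - S) \<le> card Ob" by (intro card_mono) auto
  moreover have "card (({y} + H) - S) = card H - card Q" "card Q \<le> card H"
    using card_Diff_subset_Int[of "{y} + H" S] card_mono[of "{y} + H" Q] by (auto simp: Q_def Int_commute)
  ultimately have Qcard: "card H < card Q + 2 * card (A \<inter> H)" using facts(3) by linarith
  \<comment> \<open>\<open>y\<close> is held back so that it can be added to the filled coset: y +
    (y + H) = H.\<close>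
  define Q' where "Q' = Q - {y}"
  have yQ: "y \<in> Q" using y subgrp_zero[OF sH] by (auto simp: Q_def S_def mem_singleton_plus)
  have "card Q = card Q' + 1" using yQ card_Suc_Diff1[of Q y] by (simp add: Q'_def)
  then have full: "Q' + EH = {y} + H"
    using Qcard EHcard EHsub by (intro plus_eq_coset[OF sH]) (auto simp: Q'_def Q_def)
  define H2 where "H2 = H \<union> ({y} + H)"
  have H2: "subgrp H2"
    unfolding subgrp_def
  proof (intro conjI ballI)
    show "0 \<in> H2" using subgrp_zero[OF sH] by (simp add: H2_def)
    fix a b assume "a \<in> H2" "b \<in> H2"
    then consider "a \<in> H" "b \<in> H" | "a \<in> H" "b - y \<in> H" | "a - y \<in> H" "b \<in> H" | "a - y \<in> H" "b - y \<in> H"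
      by (auto simp only: H2_def Un_iff mem_singleton_plus)
    then show "a - b \<in> H2"
    proof cases
      case 2
      have "a - (b - y) - (y + y) \<in> H" by (intro subgrp_diff[OF sH] 2 yy)
      then have "a - b - y \<in> H" by (simp add: algebra_simps)
      then show ?thesis by (simp add: H2_def mem_singleton_plus)
    next
      case 3
      have "a - y - b \<in> H" by (intro subgrp_diff[OF sH] 3)
      then have "a - b - y \<in> H" by (simp add: algebra_simps)
      then show ?thesis by (simp add: H2_def mem_singleton_plus)
    next
      case 4
      have "(a - y) - (b - y) \<in> H" by (intro subgrp_diff[OF sH] 4)
      then show ?thesis by (simp add: H2_def)
    qed (auto simp: H2_def intro: subgrp_diff[OF sH])
  qed
  define S1 where "S1 = S \<inter> H2"
  have S1: "S1 = Q \<union> (S \<inter> H)" "Q \<inter> (S \<inter> H) = {}" using yH by (auto simp: S1_def H2_def Q_def)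
  have eq: "subset_sums S1 + K = subset_sums Q + EH"
    unfolding S1(1) EH_def by (simp only: subset_sums_Un[OF S1(2)] add.assoc)
  have "H2 \<subseteq> subset_sums Q + EH"
  proof -
    have "Q' + EH \<subseteq> subset_sums Q + EH"
      by (intro set_plus_mono2 order_trans[OF subset_subset_sums subset_sums_mono]) (auto simp: Q'_def)
    then have "{y} + H \<subseteq> subset_sums Q + EH" by (simp add: full)
    moreover have "{y} + Q' \<subseteq> subset_sums Q"
    proof -
      have "{y} + Q' \<subseteq> {0, y} + subset_sums Q'"
        by (intro set_plus_mono2 subset_subset_sums) simp
      also have "\<dots> = subset_sums Q"
        using subset_sums_remove[OF yQ] by (simp only: Q'_def add.commute)
      finally show ?thesis .
    qed
    then have "{y} + Q' + EH \<subseteq> subset_sums Q + EH" by (intro set_plus_mono2) auto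
    then have "{y} + ({y} + H) \<subseteq> subset_sums Q + EH" by (simp only: add.assoc full)
    moreover have "{y} + ({y} + H) = H"
      using subgrp_plus_absorb[OF sH, of "{y + y}"] yy by (simp add: add.assoc[symmetric] singleton_plus_singleton)
    ultimately show ?thesis by (simp add: H2_def)
  qed
  moreover have "subset_sums S1 + K \<subseteq> H2 + H2"
    using KH by (intro set_plus_mono2 subset_sums_subgrp[OF H2]) (auto simp: S1_def H2_def)
  ultimately have "subset_sums S1 + K = H2" using subgrp_plus_self[OF H2] eq by simp
  then have "H2 \<subseteq> K"
    using H2 by (intro aperiodic_half_periodic_subset[OF A, of S1]) (auto simp: S1_def S_def subgrp_plus_self)
  then show False using facts(1) KH by (auto simp: H2_def)
qed

text \<open>The cosets met by S - H pair up under negation, none being its own negative by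
  \<open>noinv\<close>. Choose one from each pair and flip the signs of the elements of
  \<open>A\<close> in the others; \<open>u\<close> is the number of pairs.\<close>

lemma aperiodic_half_coset_closed:
  fixes A H :: "'a::{ab_group_add,finite} set"
  assumes A: "aperiodic_half K A" and H: "subgrp H"
  defines "S \<equiv> A \<union> uminus ` A"
  assumes noinv: "\<And>y. y \<in> S \<Longrightarrow> y \<notin> H \<Longrightarrow> y + y \<notin> H"
  shows "\<exists>B u. aperiodic_half K B \<and> B \<union> uminus ` B = S \<and> card B = card A \<and>
    card (subset_sums B + K) = card (subset_sums A + K) \<and>
    (\<forall>x\<in>B - H. S \<inter> ({x} + H) \<subseteq> B) \<and> card (insert 0 S + H) = card H + 2 * card H * u"
proof -
  define coset where "coset y = {y} + H" for y
  have coset_eq: "coset x = coset y \<longleftrightarrow> x - y \<in> H" for x y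
  proof
    have "x \<in> coset x" using subgrp_zero[OF H] by (simp add: coset_def mem_singleton_plus)
    moreover assume "coset x = coset y"
    ultimately have "x \<in> coset y" by simp
    then show "x - y \<in> H" by (simp only: coset_def mem_singleton_plus)
  next
    assume "x - y \<in> H"
    then have "x \<in> ({x} + H) \<inter> ({y} + H)" using subgrp_zero[OF H] by (simp add: mem_singleton_plus)
    then show "coset x = coset y" unfolding coset_def by (intro coset_eqI[OF H]) blast
  qed
  have neg: "uminus ` coset y = coset (- y)" for y
    by (simp add: coset_def uminus_plus uminus_subgrp[OF H])
  have negS: "- y \<in> S" if "y \<in> S" for y using that by (auto simp: S_def)
  have negH: "- y \<in> H \<longleftrightarrow> y \<in> H" for y by (rule subgrp_uminus_iff[OF H])
  define X where "X = coset ` (S - H)"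
  have "\<exists>Y. Y \<union> image uminus ` Y = X \<and> Y \<inter> image uminus ` Y = {}"
  proof (rule involution_transversal)
    fix c assume "c \<in> X"
    then obtain y where y: "y \<in> S" "y \<notin> H" "c = coset y" by (auto simp: X_def)
    show "uminus ` c \<in> X" using y negS negH unfolding X_def by (auto simp: neg)
    show "uminus ` uminus ` c = c" by (simp add: image_image)
    have "y + y \<in> H" if "coset (- y) = coset y"
      using that unfolding coset_eq using subgrp_uminus[OF H, of "- y - y"] by simp
    then show "uminus ` c \<noteq> c" using noinv y by (auto simp: neg)
  qed simp
  then obtain Y where Y: "Y \<union> image uminus ` Y = X" "Y \<inter> image uminus ` Y = {}" by blast
  have Yneg: "coset (- y) \<in> Y \<longleftrightarrow> coset y \<notin> Y" if "y \<in> S" "y \<notin> H" for y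
  proof
    assume "coset (- y) \<in> Y"
    then have "uminus ` coset (- y) \<in> image uminus ` Y" by (rule imageI)
    then have "coset y \<in> image uminus ` Y" by (simp add: neg)
    then show "coset y \<notin> Y" using Y(2) by blast
  next
    assume "coset y \<notin> Y"
    moreover have "coset y \<in> X" using that by (simp add: X_def)
    ultimately obtain c where "c \<in> Y" "coset y = uminus ` c" using Y(1) by blast
    then have "coset (- y) = c" by (simp add: neg[symmetric] image_image)
    then show "coset (- y) \<in> Y" using \<open>c \<in> Y\<close> by simp
  qed
  define F where "F = {a \<in> A. a \<notin> H \<and> coset a \<notin> Y}"
  define B where "B = (A - F) \<union> uminus ` F"
  have FA: "F \<subseteq> A" by (auto simp: F_def)
  note flip = aperiodic_half_flip[OF A FA, folded B_def]
  have BY: "coset x \<in> Y" if x: "x \<in> B" "x \<notin> H" for x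
  proof (cases "x \<in> A - F")
    case False
    then obtain a where a: "a \<in> F" "x = - a" using x by (auto simp: B_def)
    then show ?thesis using Yneg[of a] by (auto simp: F_def S_def)
  qed (use x in \<open>auto simp: F_def\<close>)
  have "S \<inter> ({x} + H) \<subseteq> B" if x: "x \<in> B - H" for x
  proof
    fix s assume s: "s \<in> S \<inter> ({x} + H)"
    then have "s - x \<in> H" using mem_singleton_plus by blast
    then have cs: "coset s = coset x" by (simp add: coset_eq)
    have "s \<notin> H" using \<open>s - x \<in> H\<close> x subgrp_diff[OF H, of s "s - x"] by auto
    have "coset s \<in> Y" using BY[of x] x cs by simp
    show "s \<in> B"
    proof (rule ccontr)
      assume "s \<notin> B"
      moreover have "s \<in> B \<union> uminus ` B" using flip(2) s by (simp add: S_def)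
      ultimately have "- s \<in> B" by auto
      then have "coset (- s) \<in> Y" using BY[of "- s"] \<open>s \<notin> H\<close> negH by blast
      then show False using Yneg[of s] s \<open>s \<notin> H\<close> \<open>coset s \<in> Y\<close> by blast
    qed
  qed
  moreover have "card (insert 0 S + H) = card H + 2 * card H * card Y"
  proof -
    have fin: "finite X" by simp
    have "card (\<Union>X) = card H * card X"
    proof (rule card_partition[symmetric])
      fix c assume "c \<in> X"
      then show "card c = card H" by (auto simp: X_def coset_def)
    next
      fix c d assume "c \<in> X" "d \<in> X" "c \<noteq> d"
      then show "c \<inter> d = {}" using coset_eqI[OF H] by (auto simp: X_def coset_def)
    qed auto
    moreover have "card X = 2 * card Y"
    proof -
      have "inj_on (image uminus) Y" by (rule inj_onI) (simp add: inj_image_eq_iff)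
      then have "card (image uminus ` Y) = card Y" by (rule card_image)
      then show ?thesis using card_Un_disjoint[of Y "image uminus ` Y"] Y by simp
    qed
    moreover have "insert 0 S + H = H \<union> \<Union>X"
    proof (intro equalityI subsetI)
      fix z assume "z \<in> insert 0 S + H"
      then obtain s h where z: "s \<in> insert 0 S" "h \<in> H" "z = s + h" by (auto elim!: set_plus_elim)
      show "z \<in> H \<union> \<Union>X"
      proof (cases "s \<in> H")
        case True
        then show ?thesis using z subgrp_add[OF H] by blast
      next
        case False
        then have "s \<in> S - H" using z subgrp_zero[OF H] by auto
        then show ?thesis using z by (auto simp: X_def coset_def)
      qed
    next
      fix z assume "z \<in> H \<union> \<Union>X"
      then consider "z \<in> H" | s where "s \<in> S" "z \<in> {s} + H" by (auto simp: X_def coset_def)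
      then show "z \<in> insert 0 S + H"
      proof cases
        case 1
        then show ?thesis using set_zero_plus2[of "insert 0 S" H] by auto
      next
        case 2
        then show ?thesis using set_plus_mono2[of "{s}" "insert 0 S" H H] by auto
      qed
    qed
    moreover have "H \<inter> \<Union>X = {}"
    proof -
      have "False" if "z \<in> H" "z \<in> {s} + H" "s \<notin> H" for z s
      proof -
        have "z - s \<in> H" using that(2) mem_singleton_plus by blast
        then show False using subgrp_diff[OF H that(1)] that(3) by force
      qed
      then show ?thesis by (auto simp: X_def coset_def)
    qed
    ultimately show ?thesis by (simp add: card_Un_disjoint)
  qed
  moreover have "B \<union> uminus ` B = S" using flip(2) by (simp only: S_def)
  ultimately show ?thesis using flip(1,3,4) by blast
qed

text \<open>Negation carries the holes of x + H to holes of -x + H, a different coset because 2x is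
  not in \<open>H\<close>. So x + H has at most half of all holes; the last inequality combines this
  with the two counts of |S + H|.\<close>

lemma tight_subgrp_coset_card:
  fixes A K H :: "'a::{ab_group_add,finite} set"
  assumes A: "aperiodic_half K A" and H: "tight_subgrp K A H"
    and large: "\<forall>B. B \<subset> A \<longrightarrow> 2 \<le> card B \<longrightarrow> large K B"
    and x: "x \<in> A" "x \<notin> H"
  defines "S \<equiv> A \<union> uminus ` A"
  assumes u: "card (insert 0 S + H) = card H + 2 * card H * u"
  shows "card (S \<inter> ({x} + H)) \<le> card H" "card H < card (S \<inter> ({x} + H)) + card (A \<inter> H)"
    "card A + card H \<le> card H * u + card (A \<inter> H) + card (S \<inter> ({x} + H))"
proof -
  define Ob where "Ob = (insert 0 S + H) - H - S"
  note facts = tight_subgrp_facts[OF A H large, folded S_def, folded Ob_def]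
  have sH: "subgrp H" using H by (simp add: tight_subgrp_def)
  define q where "q = card (S \<inter> ({x} + H))"
  define E where "E = ({x} + H) - S"
  have yH: "({y} + H) \<inter> H = {}" if "y \<notin> H" for y
  proof -
    have "y \<in> H" if "z - y \<in> H" "z \<in> H" for z using subgrp_diff[OF sH that(2,1)] by simp
    then show ?thesis using that by (auto simp: mem_singleton_plus)
  qed
  have sub: "({y} + H) - S \<subseteq> Ob" if "y \<in> S" "y \<notin> H" for y
  proof -
    have "{y} + H \<subseteq> insert 0 S + H" using that by (intro set_plus_mono2) auto
    then show ?thesis using yH[OF that(2)] by (auto simp: Ob_def)
  qed
  have mx: "- x \<in> S" "- x \<notin> H" using x subgrp_uminus_iff[OF sH] by (auto simp: S_def)
  have negS: "- y \<in> S" if "y \<in> S" for y using that by (auto simp: S_def)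
  have negE: "uminus ` E \<subseteq> ({- x} + H) - S"
  proof
    fix z assume "z \<in> uminus ` E"
    then have z: "- z \<in> E" by auto
    then have "- z - x \<in> H" by (simp add: E_def mem_singleton_plus)
    then have "- (- z - x) \<in> H" by (rule subgrp_uminus[OF sH])
    moreover have "- (- z - x) = z - (- x)" by simp
    ultimately have "z \<in> {- x} + H" by (simp only: mem_singleton_plus)
    moreover have "z \<notin> S" using z negS[of z] by (auto simp: E_def)
    ultimately show "z \<in> ({- x} + H) - S" by simp
  qed
  have "E \<inter> uminus ` E = {}"
  proof -
    have False if z: "z \<in> {x} + H" "z \<in> {- x} + H" for z
    proof -
      have "z - x \<in> H" "z - (- x) \<in> H" using z mem_singleton_plus by blast+
      then have "(z - (- x)) - (z - x) \<in> H" by (rule subgrp_diff[OF sH, rotated])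
      then show False using tight_subgrp_no_involution[OF A H large, of x] x by simp
    qed
    then show ?thesis using negE by (auto simp: E_def)
  qed
  then have "card (E \<union> uminus ` E) = 2 * card E" by (rule card_symmetrization)
  moreover have "E \<union> uminus ` E \<subseteq> Ob"
    using negE sub[OF mx] sub[of x] x by (auto simp: E_def S_def)
  then have "card (E \<union> uminus ` E) \<le> card Ob" by (intro card_mono) auto
  moreover have "card E + q = card H" "q \<le> card H"
    using card_Diff_subset_Int[of "{x} + H" S] card_mono[of "{x} + H" "S \<inter> ({x} + H)"]
    by (auto simp: E_def q_def Int_commute)
  ultimately show "card (S \<inter> ({x} + H)) \<le> card H" "card H < card (S \<inter> ({x} + H)) + card (A \<inter> H)"
    "card A + card H \<le> card H * u + card (A \<inter> H) + card (S \<inter> ({x} + H))"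
    using facts(2,3) u unfolding q_def by linarith+
qed

text \<open>A \<inter> H and a few elements of one coset produce all of x + H. The sums of the other
  elements, added to this coset, form \<open>E\<close>, and the assumption \<open>large\<close> for
  these elements bounds its size.\<close>

lemma tight_subgrp_periodic_part:
  fixes A K H :: "'a::{ab_group_add,finite} set"
  assumes A: "aperiodic_half K A" and H: "tight_subgrp K A H"
    and large: "\<forall>B. B \<subset> A \<longrightarrow> 2 \<le> card B \<longrightarrow> large K B"
  defines "S \<equiv> A \<union> uminus ` A"
  assumes closed: "\<forall>x\<in>A - H. S \<inter> ({x} + H) \<subseteq> A"
    and v: "card (insert 0 S + H) = card H + 2 * card H * Suc v"
  shows "\<exists>E \<subseteq> subset_sums A + K. E + H = E \<and> E \<noteq> {} \<and>
    (1 \<le> v \<longrightarrow> (v * card H + 1) * (v * card H) + 6 \<le> 2 * card E)"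
proof -
  define Ob where "Ob = (insert 0 S + H) - H - S"
  define CH where "CH = subset_sums (A \<inter> H) + K"
  note facts = tight_subgrp_facts[OF A H large, folded S_def, folded Ob_def CH_def]
  have K: "subgrp K" by (rule aperiodic_half_subgrp[OF A])
  have sH: "subgrp H" and KH: "K \<subseteq> H" and AH: "\<not> A \<subseteq> H"
    using H by (auto simp: tight_subgrp_def)
  obtain x where x: "x \<in> A" "x \<notin> H" using AH by blast
  define Q where "Q = S \<inter> ({x} + H)"
  note coset = tight_subgrp_coset_card[OF A H large x, folded S_def, OF v, folded Q_def]
  have QA: "Q \<subseteq> A" using closed x by (auto simp: Q_def)
  \<comment> \<open>This is the least size for which the pigeonhole with \<open>CH\<close> fills the
    coset. It leads to |R| \<le> |H|, because |CH| \<ge> 2|A \<inter> H| > 0.\<close>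
  have "card H + 1 - card CH \<le> card Q" using coset(2) facts(4) by linarith
  then obtain Y where Y: "Y \<subseteq> Q" "card Y = card H + 1 - card CH"
    using obtain_subset_with_card_n by metis
  have "CH \<subseteq> H + H" unfolding CH_def using KH by (intro set_plus_mono2 subset_sums_subgrp[OF sH]) auto
  then have CH: "CH \<subseteq> H" by (simp add: subgrp_plus_self[OF sH])
  have full: "Y + CH = {x} + H"
    using Y facts(6) by (intro plus_eq_coset[OF sH _ CH]) (auto simp: Q_def)
  have QH: "Q \<inter> H = {}"
  proof -
    have "x \<in> H" if "z - x \<in> H" "z \<in> H" for z using subgrp_diff[OF sH that(2,1)] by simp
    then show ?thesis using x by (auto simp: Q_def mem_singleton_plus)
  qed
  define R where "R = (A \<inter> H) \<union> Y"
  define E where "E = subset_sums (A - R) + ({x} + H)"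
  have RA: "R \<subseteq> A" and disj: "(A \<inter> H) \<inter> Y = {}" using Y QA QH by (auto simp: R_def)
  have "subset_sums R = subset_sums (A \<inter> H) + subset_sums Y"
    unfolding R_def by (rule subset_sums_Un[OF disj])
  then have C: "subset_sums A + K = subset_sums (A - R) + (subset_sums Y + CH)"
    unfolding subset_sums_Diff[OF RA] CH_def by (simp only: ac_simps)
  have "E \<subseteq> subset_sums A + K"
    unfolding C E_def full[symmetric] by (intro set_plus_mono2 subset_subset_sums order_refl)
  moreover have "E + H = E" by (simp only: E_def add.assoc subgrp_plus_self[OF sH])
  moreover have "E \<noteq> {}"
    using set_plus_intro[OF zero_in_subset_sums[of "A - R"], of x "{x} + H"] subgrp_zero[OF sH]
    by (auto simp: E_def mem_singleton_plus)
  moreover have "(v * card H + 1) * (v * card H) + 6 \<le> 2 * card E" if v1: "1 \<le> v"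
  proof -
    define h where "h = card H"
    have "{x} + (subset_sums (A - R) + K) \<subseteq> {x} + (subset_sums (A - R) + H)"
      using KH by (intro set_plus_mono2) auto
    also have "\<dots> = E" by (simp only: E_def add.left_commute)
    finally have "card ({x} + (subset_sums (A - R) + K)) \<le> card E" by (intro card_mono) auto
    then have le: "card (subset_sums (A - R) + K) \<le> card E" by simp
    have "card R = card (A \<inter> H) + card Y" using disj by (simp add: R_def card_Un_disjoint)
    moreover have "card (A - R) = card A - card R" using RA by (simp add: card_Diff_subset)
    moreover have "card H * Suc v < card A" using facts(2,3) v by linarith
    then have "h + v * h + 1 \<le> card A" by (simp add: h_def algebra_simps)
    ultimately have cAR: "v * h + 1 \<le> card (A - R)"
      using Y(2) facts(3,4,6) unfolding h_def by linarith
    have "h \<ge> 1" using card_subgrp_pos[OF sH] by (simp add: h_def)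
    then have "1 \<le> v * h" using v1 by simp
    have "A - R \<subset> A" using facts(7) by (auto simp: R_def)
    moreover have "2 \<le> card (A - R)" using cAR \<open>1 \<le> v * h\<close> by linarith
    ultimately have "large K (A - R)" using large by blast
    then have l: "card (A - R) * (card (A - R) - 1) + 2 * card K + 4 \<le> 2 * card (subset_sums (A - R) + K)"
      unfolding large_def .
    have m: "(v * h + 1) * (v * h) \<le> card (A - R) * (card (A - R) - 1)"
    proof (rule mult_le_mono[OF cAR])
      show "v * h \<le> card (A - R) - 1" using cAR by linarith
    qed
    have "card K \<ge> 1" using card_subgrp_pos[OF K] by simp
    then show ?thesis unfolding h_def[symmetric] using l m le by linarith
  qed
  ultimately show ?thesis by (intro exI[of _ E]) blast
qed

section \<open>Olson's argument for a maximal tight subgroup\<close>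

text \<open>Olson's inequality with gains at most vh and growth 2h(v+1) is impossible. For v = 0
  nothing is gained. Otherwise, with t = hv, it reduces to 4W^2 \<le> v(4Wt + t^2), against 2W \<ge>
  t^2 + t and 2v \<le> t.\<close>

lemma olson_coset_contradiction:
  fixes h v W :: real
  assumes h: "h \<ge> 2" and v: "v = 0 \<or> v \<ge> 1" and W: "W > 0"
    and big: "v \<ge> 1 \<Longrightarrow> (v * h + 1) * (v * h) + 6 \<le> 2 * W"
    and le: "8 * (2 * h * (v + 1)) * W\<^sup>2 \<le> (v * h) * (4 * W - 2 * h + 2 * h * (v + 1))\<^sup>2"
  shows False
  using v
proof
  assume "v = 0"
  then have "16 * h * W\<^sup>2 \<le> 0" using le by simp
  moreover have "16 * h * W\<^sup>2 > 0" using h W by simp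
  ultimately show False by linarith
next
  assume v: "v \<ge> 1"
  define t where "t = h * v"
  have t: "t \<ge> 2" using mult_mono[of 2 h 1 v] h v by (simp add: t_def)
  have e: "(4 * W - 2 * h + 2 * h * (v + 1)) = 2 * (2 * W + t)" by (simp add: t_def algebra_simps)
  have "h * (16 * (v + 1) * W\<^sup>2) \<le> h * (4 * v * (2 * W + t)\<^sup>2)"
    using le unfolding e by (simp add: power2_eq_square algebra_simps)
  then have "16 * (v + 1) * W\<^sup>2 \<le> 4 * v * (2 * W + t)\<^sup>2" using h by simp
  then have 1: "4 * W\<^sup>2 \<le> v * (4 * W * t + t\<^sup>2)" by (simp add: power2_eq_square algebra_simps)
  have W2: "2 * W \<ge> t * t + t" using big[OF v] by (simp add: t_def algebra_simps)
  have "t * v \<le> t * t / 2"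
  proof -
    have "v * 2 \<le> v * h" using h v by (intro mult_left_mono) auto
    then have "2 * v \<le> t" by (simp add: t_def mult.commute)
    then have "t * (2 * v) \<le> t * t" using t by (intro mult_left_mono) auto
    then show ?thesis by simp
  qed
  then have W3: "W - v * t \<ge> t / 2" using W2 by (simp add: mult.commute)
  have "2 * W * t \<le> 4 * W * (W - v * t)"
    using mult_left_mono[OF W3, of "4 * W"] W by simp
  also have "\<dots> = 4 * W\<^sup>2 - v * (4 * W * t)" by (simp add: power2_eq_square algebra_simps)
  also have "\<dots> \<le> v * t\<^sup>2" using 1 by (simp add: algebra_simps)
  finally have "(2 * W) * t \<le> (v * t) * t" by (simp add: power2_eq_square)
  then have "2 * W \<le> v * t" using t by simp
  moreover have "v * t > 0" using v t by simp
  moreover have "v * t \<le> W" using W3 t by simp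
  ultimately show False by linarith
qed

text \<open>Gains of \<Sigma>(A) + H are multiples of |H|, so if the claim failed they would be at
  most v|H|. By maximality of \<open>H\<close> the sumsets starting at \<open>H\<close> grow by
  2|H|(v+1), and Olson's inequality gives a contradiction.\<close>

lemma tight_subgrp_large_gain:
  fixes A K H G :: "'a::{ab_group_add,finite} set"
  assumes A: "aperiodic_half K A" and H: "tight_subgrp K A H"
    and large: "\<forall>B. B \<subset> A \<longrightarrow> 2 \<le> card B \<longrightarrow> large K B"
  defines "S \<equiv> A \<union> uminus ` A"
  assumes closed: "\<forall>x\<in>A - H. S \<inter> ({x} + H) \<subseteq> A"
    and v: "card (insert 0 S + H) = card H + 2 * card H * Suc v"
    and G: "subgrp G" "insert 0 S \<subseteq> G" "H \<subseteq> G"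
      "\<And>Q. subgrp Q \<Longrightarrow> insert 0 S \<subseteq> Q \<Longrightarrow> K \<subseteq> Q \<Longrightarrow> G \<subseteq> Q"
    and max: "\<forall>P. H \<subset> P \<longrightarrow> P \<subseteq> G \<longrightarrow> \<not> tight_subgrp K A P"
  shows "\<exists>x\<in>A - H. card H * Suc v \<le> shift_gain (subset_sums A + H) x"
proof (rule ccontr)
  assume small: "\<not> ?thesis"
  define Ob where "Ob = (insert 0 S + H) - H - S"
  define CH where "CH = subset_sums (A \<inter> H) + K"
  note facts = tight_subgrp_facts[OF A H large, folded S_def, folded Ob_def CH_def]
  have K: "subgrp K" by (rule aperiodic_half_subgrp[OF A])
  have sH: "subgrp H" and KH: "K \<subseteq> H" and AH: "\<not> A \<subseteq> H"
    using H by (auto simp: tight_subgrp_def)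
  have AG: "A \<subseteq> G" using G(2) by (auto simp: S_def)
  have KHH: "K + H = H" using KH subgrp_zero[OF K] by (intro subgrp_plus_absorb[OF sH]) auto
  define h where "h = card H"
  define C where "C = subset_sums A + K"
  define D where "D = subset_sums A + H"
  have DC: "D = C + H" by (simp only: C_def D_def add.assoc KHH)
  have DH: "D + H = D" by (simp only: D_def add.assoc subgrp_plus_self[OF sH])
  have "D \<subseteq> G + G" unfolding D_def using AG G by (intro set_plus_mono2 subset_sums_subgrp[OF G(1)])
  then have DG: "D \<subseteq> G" by (simp add: subgrp_plus_self[OF G(1)])
  obtain E where E: "E \<subseteq> C" "E + H = E" "E \<noteq> {}" "1 \<le> v \<Longrightarrow> (v * h + 1) * (v * h) + 6 \<le> 2 * card E"
    using tight_subgrp_periodic_part[OF A H large, folded S_def, OF closed v] unfolding C_def h_def by blast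
  have CD: "C \<subseteq> D" unfolding DC by (rule subset_plus_right[OF subgrp_zero[OF sH]])
  then have ED: "card E \<le> card D" using E(1) by (intro card_mono) auto
  \<comment> \<open>This makes \<open>D\<close> and its complement both at least as large as
    \<open>E\<close>. Otherwise D - E = G by the pigeonhole; as \<open>E\<close> is
    \<open>H\<close>-periodic, D - E = C - E, so C - C = G and \<open>G\<close> would lie in
    \<open>K\<close>.\<close>
  have EG: "card E + card D \<le> card G"
  proof (rule ccontr)
    assume n: "\<not> ?thesis"
    have "uminus ` E \<subseteq> uminus ` G" using E(1) CD DG by (intro image_mono) auto
    then have "uminus ` E \<subseteq> G" by (simp add: uminus_subgrp[OF G(1)])
    moreover have "card (uminus ` E) = card E" by (simp add: card_image)
    ultimately have "D + uminus ` E = {0} + G"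
      using n DG by (intro plus_eq_coset[OF G(1)]) (auto simp: mem_singleton_plus)
    then have "D + uminus ` E = G" by (simp add: set_zero[symmetric] del: set_zero)
    moreover have "D + uminus ` E = C + uminus ` E"
    proof -
      have "uminus ` E = uminus ` E + H" using E(2) uminus_plus[of E H] uminus_subgrp[OF sH] by simp
      then show ?thesis unfolding DC by (metis add.assoc add.commute)
    qed
    moreover have "C + uminus ` E \<subseteq> C + uminus ` C" using E(1) by (intro set_plus_mono2 image_mono) auto
    moreover have CZ: "C + uminus ` C = subset_sums (A \<union> uminus ` A) + K"
      using A K by (simp add: C_def subset_sums_symmetric aperiodic_half_def)
    moreover have "subset_sums (A \<union> uminus ` A) + K \<subseteq> G + G"
      using G KH by (intro set_plus_mono2 subset_sums_subgrp[OF G(1)]) (auto simp: S_def)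
    ultimately have "subset_sums (A \<union> uminus ` A) + K = G"
      by (simp add: subgrp_plus_self[OF G(1)])
    then have "G \<subseteq> K"
      using G(1) by (intro aperiodic_half_periodic_subset[OF A order_refl]) (auto simp: subgrp_plus_self)
    then show False using KH G(3) facts(1) by blast
  qed
  \<comment> \<open>Olson's inequality needs a set of at most half the size of the group\<close>
  define D' where "D' = (if 2 * card D \<le> card G then D else G - D)"
  have D': "2 * card D' \<le> card G" "card E \<le> card D'"
    using ED EG DG card_mono[of G D] by (auto simp: D'_def card_Diff_subset)
  have gain: "shift_gain D' g = shift_gain D g" if "g \<in> G" for g
    using shift_gain_compl[OF G(1) DG that] by (simp add: D'_def)
  have perD: "H \<subseteq> period D" using DH by (simp add: subset_period_iff[OF sH])
  have perD': "H \<subseteq> period D'"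
  proof
    fix g assume g: "g \<in> H"
    then have "shift_gain D' g = 0" using gain G(3) perD shift_gain_period by (metis subsetD)
    then have "{g} + D' \<subseteq> D'" by (simp add: shift_gain_def)
    then show "g \<in> period D'" by (rule periodI)
  qed
  have gainA: "shift_gain D a \<le> v * h" if a: "a \<in> A" for a
  proof (cases "a \<in> H")
    case True
    then show ?thesis using perD shift_gain_period[of a D] by auto
  next
    case False
    then have lt: "shift_gain D a < h * Suc v"
      using small a unfolding D_def h_def by (meson DiffI not_le_imp_less)
    have "(({a} + D) - D) + H = ({a} + D) - D"
    proof (intro equalityI subsetI)
      fix z assume "z \<in> (({a} + D) - D) + H"
      then obtain w g where z: "z = w + g" "g \<in> H" "w \<in> {a} + D" "w \<notin> D" by (auto elim!: set_plus_elim)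
      have "w + g \<in> {a} + D + H" using z by blast
      then have "w + g \<in> {a} + D" by (simp only: add.assoc DH)
      moreover have "(w + g) + (- g) \<in> D + H" if "w + g \<in> D"
        using that z(2) by (intro set_plus_intro subgrp_uminus[OF sH])
      ultimately show "z \<in> ({a} + D) - D" using z by (auto simp: DH)
    qed (use subset_plus_right[OF subgrp_zero[OF sH]] in blast)
    then have "h dvd shift_gain D a"
      unfolding shift_gain_def h_def by (intro dvd_card_periodic[OF sH])
    then obtain n where n: "shift_gain D a = h * n" by blast
    then have "n < Suc v" using lt by (simp only: mult_less_cancel1)
    then show ?thesis using n by (simp add: mult.commute)
  qed
  have gainS: "real (shift_gain D' x) \<le> real (v * h)" if x: "x \<in> insert 0 S" for x
  proof -
    have "shift_gain D' x = shift_gain D x" using gain G(2) x by blast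
    moreover consider "x = 0" | "x \<in> A" | "- x \<in> A" using x by (auto simp: S_def)
    then have "shift_gain D x \<le> v * h"
    proof cases
      case 1
      then show ?thesis using perD subgrp_zero[OF sH] shift_gain_period[of 0 D] by auto
    next
      case 3
      then show ?thesis using gainA[of "- x"] by (simp add: shift_gain_uminus)
    qed (rule gainA)
    ultimately show ?thesis by (metis of_nat_le_iff)
  qed
  define d where "d = 2 * h * Suc v"
  have dm: "d < 2 * card A" using facts(2,3) v unfolding d_def h_def by linarith
  have grow: "card H + d * j \<le> card (iter_plus H (insert 0 S) j) \<or> iter_plus H (insert 0 S) j = G" for j
  proof (rule iter_plus_growth[OF G(1,2)])
    fix Q assume "subgrp Q" "insert 0 S \<subseteq> Q" "H \<subseteq> Q"
    then show "G \<subseteq> Q" using G(4) KH by blast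
  next
    fix P assume P: "subgrp P" "H \<subseteq> P" "P \<subseteq> G" "\<not> insert 0 S \<subseteq> P"
    \<comment> \<open>For \<open>P = H\<close> the growth is the number of cosets counted by
      \<open>v\<close>. A larger \<open>P\<close> is not tight and gives 2|A|, which exceeds
      \<open>d\<close>.\<close>
    show "d + card P \<le> card (insert 0 S + P)"
    proof (cases "P = H")
      case True
      then show ?thesis using v by (simp add: d_def h_def)
    next
      case False
      then have "\<not> tight_subgrp K A P" using max P by blast
      moreover have "\<not> A \<subseteq> P"
        using P(1,4) subgrp_zero[OF P(1)] subgrp_uminus[OF P(1)] by (auto simp: S_def)
      ultimately show ?thesis using P KH dm by (auto simp: tight_subgrp_def S_def)
    qed
  qed (use sH G in auto)
  have "h \<ge> 2"
    using facts(5,6) card_subgrp_pos[OF K] by (simp add: h_def)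
  have "d > 0" using \<open>h \<ge> 2\<close> by (simp add: d_def)
  have ineq: "8 * real d * (real (card D'))\<^sup>2 \<le> real (v * h) * (4 * real (card D') - 2 * real (card H) + real d)\<^sup>2"
    by (rule olson_inequality[OF _ perD' gainS grow D'(1) \<open>d > 0\<close>]) auto
  show False
  proof (rule olson_coset_contradiction)
    show "real h \<ge> 2" using \<open>h \<ge> 2\<close> by simp
    show "real v = 0 \<or> real v \<ge> 1" by (cases v) auto
    have "card E > 0" using E(3) by (simp add: card_gt_0_iff)
    then show "real (card D') > 0" using D'(2) by simp
    show "(real v * real h + 1) * (real v * real h) + 6 \<le> 2 * real (card D')" if "1 \<le> real v"
    proof -
      have "(v * h + 1) * (v * h) + 6 \<le> 2 * card D'" using E(4) D'(2) that by linarith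
      then have "real ((v * h + 1) * (v * h) + 6) \<le> real (2 * card D')" by (simp only: of_nat_le_iff)
      then show ?thesis by (simp add: algebra_simps)
    qed
    show "8 * (2 * real h * (real v + 1)) * (real (card D'))\<^sup>2
        \<le> real v * real h * (4 * real (card D') - 2 * real h + 2 * real h * (real v + 1))\<^sup>2"
    proof -
      have "real d = 2 * real h * (real v + 1)" by (simp add: d_def algebra_simps)
      then show ?thesis using ineq by (simp only: h_def[symmetric] of_nat_mult)
    qed
  qed
qed

section \<open>The lower bound\<close>

text \<open>Since s = 2t - 1, the difference m(m-1) - n(n-1) equals 2s(m - t). Here \<open>D\<close>
  is the cost of one removal.\<close>

lemma removal_arith:
  fixes n s t D m :: nat
  assumes "m = n + s" "s + 1 = 2 * t" "m \<le> D + t" "n \<ge> 1"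
  shows "m * (m - 1) \<le> n * (n - 1) + 2 * (D * s)"
proof -
  have "int n + int s - int t \<le> int D" using assms by linarith
  then have "(int n + int s - int t) * int s \<le> int D * int s" by (intro mult_right_mono) auto
  moreover have "2 * int t = int s + 1" using assms(2) by linarith
  then have "2 * ((int n + int s - int t) * int s) = 2 * int n * int s + 2 * int s * int s - (int s + 1) * int s"
    by (simp add: algebra_simps)
  ultimately have "(int n + int s) * (int n + int s - 1) \<le> int n * (int n - 1) + 2 * (int D * int s)"
    by (simp add: algebra_simps)
  then have "int (m * (m - 1)) \<le> int (n * (n - 1) + 2 * (D * s))"
    using assms(1,4) by (simp add: of_nat_diff)
  then show ?thesis by (simp only: of_nat_le_iff)
qed

text \<open>Each of \<open>s\<close> removals from a coset with large gain costs at least |H|(v+1).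
  Adding this to the bound for the remaining set gives the bound for \<open>A\<close>.\<close>

lemma tight_subgrp_imp_large:
  fixes A K H G :: "'a::{ab_group_add,finite} set"
  assumes A: "aperiodic_half K A" and H: "tight_subgrp K A H"
    and large: "\<forall>B. B \<subset> A \<longrightarrow> 2 \<le> card B \<longrightarrow> large K B"
  defines "S \<equiv> A \<union> uminus ` A"
  assumes closed: "\<forall>x\<in>A - H. S \<inter> ({x} + H) \<subseteq> A"
    and v: "card (insert 0 S + H) = card H + 2 * card H * Suc v"
    and G: "subgrp G" "insert 0 S \<subseteq> G" "H \<subseteq> G"
      "\<And>Q. subgrp Q \<Longrightarrow> insert 0 S \<subseteq> Q \<Longrightarrow> K \<subseteq> Q \<Longrightarrow> G \<subseteq> Q"
    and max: "\<forall>P. H \<subset> P \<longrightarrow> P \<subseteq> G \<longrightarrow> \<not> tight_subgrp K A P"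
  shows "large K A"
proof -
  define Ob where "Ob = (insert 0 S + H) - H - S"
  define CH where "CH = subset_sums (A \<inter> H) + K"
  note facts = tight_subgrp_facts[OF A H large, folded S_def, folded Ob_def CH_def]
  have K: "subgrp K" by (rule aperiodic_half_subgrp[OF A])
  have sH: "subgrp H" and KH: "K \<subseteq> H" using H by (auto simp: tight_subgrp_def)
  obtain x where x: "x \<in> A" "x \<notin> H" and gain: "card H * Suc v \<le> shift_gain (subset_sums A + H) x"
    using tight_subgrp_large_gain[OF A H large, folded S_def, OF closed v G max] by blast
  define Q where "Q = S \<inter> ({x} + H)"
  note coset = tight_subgrp_coset_card[OF A H large x, folded S_def, OF v, folded Q_def]
  have QA: "Q \<subseteq> A" using closed x by (auto simp: Q_def)
  \<comment> \<open>\<open>t\<close> is |A \<inter> H| minus the number of holes of x + H. With s =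
    2t - 1 the arithmetic closes, and |H| + s < |Q| + |CH| still holds because 2|A \<inter> H| \<le>
    |CH|.\<close>
  define t where "t = card (A \<inter> H) + card Q - card H"
  define s where "s = 2 * t - 1"
  have t: "t \<ge> 1" "t \<le> card (A \<inter> H)" "t + card H = card (A \<inter> H) + card Q"
    using coset(1,2) by (auto simp: t_def)
  have s: "s + 1 = 2 * t" using t(1) by (simp add: s_def)
  have sQ: "s < card Q" using s t facts(4,6) by linarith
  then obtain R where R: "R \<subseteq> Q" "card R = s"
    using obtain_subset_with_card_n[of s Q] by auto
  have "card H + card R < card Q + card CH" using R(2) s t facts(4) coset(1) by linarith
  then have step: "card (subset_sums (A - R) + K) + card H * Suc v * s \<le> card (subset_sums A + K)"
    using card_subset_sums_remove_coset[OF sH K KH QA _ x(2) gain R(1)] sQ R(2)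
    by (auto simp: Q_def CH_def)
  have "card H * Suc v < card A" using facts(2,3) v by linarith
  moreover have "card H \<le> card H * Suc v" by simp
  ultimately have mA: "card H < card A" by linarith
  have cAR: "card (A - R) = card A - s" using R QA by (simp add: card_Diff_subset)
  have big: "card (A - R) \<ge> 2" unfolding cAR using mA s t facts(4,6) by linarith
  have "R \<noteq> {}" using R(2) s t(1) by auto
  then have "A - R \<subset> A" using R(1) QA by blast
  then have "large K (A - R)" using large big by blast
  then have l: "card (A - R) * (card (A - R) - 1) + 2 * card K + 4 \<le> 2 * card (subset_sums (A - R) + K)"
    unfolding large_def .
  have "card A * (card A - 1) \<le> card (A - R) * (card (A - R) - 1) + 2 * (card H * Suc v * s)"
  proof (rule removal_arith[OF _ s])
    show "card A = card (A - R) + s" using cAR big by linarith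
    show "card A \<le> card H * Suc v + t" using coset(3) t(3) by linarith
  qed (use big in simp)
  then show ?thesis unfolding large_def using l step by linarith
qed

lemma tight_subgrp_cong:
  assumes "B \<union> uminus ` B = A \<union> uminus ` A" "card B = card A"
  shows "tight_subgrp K B P \<longleftrightarrow> tight_subgrp K A P"
proof (cases "subgrp P")
  case True
  have "X \<subseteq> P \<longleftrightarrow> X \<union> uminus ` X \<subseteq> P" for X
    using subgrp_uminus[OF True] by auto
  then have "B \<subseteq> P \<longleftrightarrow> A \<subseteq> P" using assms(1) by metis
  then show ?thesis using assms by (simp add: tight_subgrp_def)
qed (simp add: tight_subgrp_def)

text \<open>The required size is |K| + 3. The coset count 3|K| reaches it unless \<open>K\<close> is
  trivial, where the four sums 0, a, b, a + b are distinct.\<close>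

lemma large_pair:
  fixes A :: "'a::{ab_group_add,finite} set"
  assumes A: "aperiodic_half K A" and card: "card A = 2"
  shows "large K A"
proof (cases "card K = 1")
  case True
  obtain a b where ab: "A = {a, b}" "a \<noteq> b" using card by (auto simp: card_2_iff)
  have K: "subgrp K" by (rule aperiodic_half_subgrp[OF A])
  have "0 \<notin> A" using aperiodic_half_disjoint[OF A] subgrp_zero[OF K] by blast
  moreover have "a \<noteq> - b" using A ab by (auto simp: aperiodic_half_def)
  then have "a + b \<noteq> 0" by (simp add: eq_neg_iff_add_eq_0)
  ultimately have "card {0, a, b, a + b} = 4" using ab by (auto simp: card_insert_if)
  moreover have "{0, a, b, a + b} \<subseteq> subset_sums A"
  proof -
    have "\<Sum>A = a + b" using ab by simp
    then have "a + b \<in> subset_sums A" unfolding subset_sums_def by (intro CollectI exI[of _ A]) simp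
    then show ?thesis using zero_in_subset_sums subset_subset_sums[of A] ab by auto
  qed
  then have "{0, a, b, a + b} \<subseteq> subset_sums A + K"
    using subset_plus_right[OF subgrp_zero[OF K]] by blast
  then have "card {0, a, b, a + b} \<le> card (subset_sums A + K)" by (intro card_mono) auto
  ultimately show ?thesis using True card by (simp add: large_def)
next
  case False
  then have "card K \<ge> 2" using card_subgrp_pos[OF aperiodic_half_subgrp[OF A]] by linarith
  then show ?thesis using card_aperiodic_half_ge[OF A] card by (simp add: large_def)
qed

text \<open>If the bound failed, the one for \<open>A\<close> without an element would leave room
  only for gains up to |A| - 2. With growth 2|A| in each step this violates Olson's
  inequality.\<close>

lemma large_if_no_tight_subgrp:
  fixes A K G :: "'a::{ab_group_add,finite} set"
  assumes A: "aperiodic_half K A" and m: "card A \<ge> 3"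
    and large: "\<forall>B. B \<subset> A \<longrightarrow> 2 \<le> card B \<longrightarrow> large K B"
  defines "S \<equiv> A \<union> uminus ` A"
  assumes G: "subgrp G" "insert 0 S \<subseteq> G" "K \<subseteq> G"
      "\<And>Q. subgrp Q \<Longrightarrow> insert 0 S \<subseteq> Q \<Longrightarrow> K \<subseteq> Q \<Longrightarrow> G \<subseteq> Q"
    and none: "\<And>P. P \<subseteq> G \<Longrightarrow> \<not> tight_subgrp K A P"
  shows "large K A"
proof (rule ccontr)
  assume "\<not> large K A"
  define m k c where "m = card A" and "k = card K" and "c = card (subset_sums A + K)"
  note defs = this
  have K: "subgrp K" by (rule aperiodic_half_subgrp[OF A])
  have lt: "2 * c < m * (m - 1) + 2 * k + 4"
    using \<open>\<not> large K A\<close> by (simp add: large_def defs)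
  have m3: "m \<ge> 3" using m by (simp add: defs)
  have k1: "k \<ge> 1" using card_subgrp_pos[OF K] by (simp add: defs)
  define C where "C = subset_sums A + K"
  have gain: "(m - 1) * (m - 2) + 2 * k + 4 + 2 * shift_gain C a \<le> 2 * c" if a: "a \<in> A" for a
  proof -
    have card: "card (A - {a}) = m - 1" "m - 1 - 1 = m - 2" using a by (simp_all add: m_def)
    have "A - {a} \<subset> A" "2 \<le> card (A - {a})" using a m3 card(1) by auto
    then have "large K (A - {a})" using large by blast
    then have "(m - 1) * (m - 2) + 2 * k + 4 \<le> 2 * card (subset_sums (A - {a}) + K)"
      unfolding large_def card k_def[symmetric] .
    then show ?thesis
      using shift_gain_subset_sums_le[OF a, of K] unfolding C_def c_def by linarith
  qed
  \<comment> \<open>\<open>L\<close> is the excess of \<open>c\<close> over the bound available for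
    \<open>m - 1\<close> elements.\<close>
  define L :: real where "L = real c - ((real m - 1) * (real m - 2) / 2 + real k + 2)"
  have gainL: "real (shift_gain C a) \<le> L" if a: "a \<in> A" for a
  proof -
    have "real ((m - 1) * (m - 2) + 2 * k + 4 + 2 * shift_gain C a) \<le> real (2 * c)"
      using gain[OF a] by (simp only: of_nat_le_iff)
    then show ?thesis using m3 by (simp add: L_def of_nat_diff)
  qed
  obtain a where "a \<in> A" using m by (metis card.empty ex_in_conv not_numeral_le_zero)
  then have L0: "0 \<le> L" using gainL[of a] by linarith
  \<comment> \<open>Parity sharpens \<open>lt\<close> to c \<le> m(m-1)/2 + k + 1, which yields L
    \<le> m - 2.\<close>
  have "even (m * (m - 1))" by (cases m) auto
  then obtain w where w: "m * (m - 1) = 2 * w" by blast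
  then have "c \<le> w + k + 1" using lt by linarith
  then have "real c \<le> real w + real k + 1" by linarith
  moreover have "real m * (real m - 1) = 2 * real w"
  proof -
    have "real (m * (m - 1)) = real (2 * w)" by (simp only: w)
    then show ?thesis using m3 by (simp add: of_nat_diff)
  qed
  ultimately have Lm: "L \<le> real m - 2" by (simp add: L_def field_simps)
  have gainS: "real (shift_gain C x) \<le> L" if x: "x \<in> insert 0 S" for x
  proof -
    consider "x = 0" | "x \<in> A" | "- x \<in> A" using x by (auto simp: S_def)
    then show ?thesis
    proof cases
      case 1
      then show ?thesis
        using L0 shift_gain_period[OF subgrp_zero[OF subgrp_period], of C] by simp
    next
      case 3
      then show ?thesis using gainL[of "- x"] by (simp add: shift_gain_uminus)
    qed (rule gainL)
  qed
  have grow: "card K + 2 * m * j \<le> card (iter_plus K (insert 0 S) j) \<or> iter_plus K (insert 0 S) j = G" for j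
  proof (rule iter_plus_growth[OF G(1,2)])
    fix Q assume "subgrp Q" "insert 0 S \<subseteq> Q" "K \<subseteq> Q"
    then show "G \<subseteq> Q" by (rule G(4))
  next
    fix P assume P: "subgrp P" "K \<subseteq> P" "P \<subseteq> G" "\<not> insert 0 S \<subseteq> P"
    then have "\<not> A \<subseteq> P"
      using subgrp_zero[OF P(1)] subgrp_uminus[OF P(1)] by (auto simp: S_def)
    then show "2 * m + card P \<le> card (insert 0 S + P)"
      using none[OF P(3)] P(1,2) by (auto simp: tight_subgrp_def S_def m_def)
  qed (use K G(3) in auto)
  have per: "K \<subseteq> period C"
    unfolding subset_period_iff[OF K] C_def by (rule plus_subgrp_absorb[OF K])
  have AG: "A \<subseteq> G" using G(2) by (auto simp: S_def)
  have "2 * card C \<le> card G"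
    unfolding C_def using \<open>a \<in> A\<close> G(1,3) AG by (intro card_aperiodic_half_le[OF A]) auto
  then have "8 * real (2 * m) * (real (card C))\<^sup>2 \<le> L * (4 * real (card C) - 2 * real (card K) + real (2 * m))\<^sup>2"
    using m3 by (intro olson_inequality[OF _ per gainS grow]) auto
  moreover have "card C = c" "card K = k" by (simp_all add: C_def defs)
  moreover define p where "p = 2 * real c - real k + real m"
  have "4 * real c - 2 * real k + real (2 * m) = 2 * p" by (simp add: p_def)
  ultimately have "8 * real (2 * m) * (real c)\<^sup>2 \<le> L * (2 * p)\<^sup>2" by simp
  then have "4 * real m * (real c)\<^sup>2 \<le> L * p\<^sup>2" by (simp add: power_mult_distrib)
  moreover have "L * p\<^sup>2 < 4 * real m * (real c)\<^sup>2"
    unfolding p_def using m3 k1 L0 Lm by (intro olson_bound_strict) (auto simp: L_def)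
  ultimately show False by linarith
qed

text \<open>Strong induction on |A|. If tight subgroups exist inside the subgroup \<open>G\<close>
  generated by \<open>S\<close> and \<open>K\<close>, a maximal one is chosen and \<open>A\<close>
  is exchanged for a half adapted to its cosets, which changes neither the sizes nor
  tightness.\<close>

theorem aperiodic_half_large:
  fixes A :: "'a::{ab_group_add,finite} set"
  assumes "aperiodic_half K A" "2 \<le> card A"
  shows "large K A"
  using assms
proof (induction "card A" arbitrary: A rule: less_induct)
  case less
  note A = less.prems(1)
  \<comment> \<open>Stated for every half of size |A|, because it is used for \<open>A\<close> and
    for the adapted half \<open>B\<close>.\<close>
  have IH: "\<forall>B. B \<subset> A' \<longrightarrow> 2 \<le> card B \<longrightarrow> large K B"
    if "aperiodic_half K A'" "card A' = card A" for A'
  proof (intro allI impI)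
    fix B assume B: "B \<subset> A'" "2 \<le> card B"
    then have "card B < card A" using psubset_card_mono[of A' B] that(2) by simp
    then show "large K B"
      using B by (intro less.hyps aperiodic_half_subset[OF that(1)]) auto
  qed
  define S where "S = A \<union> uminus ` A"
  define G where "G = \<Inter> {Q. subgrp Q \<and> insert 0 S \<subseteq> Q \<and> K \<subseteq> Q}"
  have sG: "subgrp G" unfolding G_def subgrp_def by blast
  have SG: "insert 0 S \<subseteq> G" and KG: "K \<subseteq> G" unfolding G_def by blast+
  have Gmin: "G \<subseteq> Q" if "subgrp Q" "insert 0 S \<subseteq> Q" "K \<subseteq> Q" for Q
    using that unfolding G_def by blast
  consider "card A = 2" | "card A \<ge> 3" "\<And>P. P \<subseteq> G \<Longrightarrow> \<not> tight_subgrp K A P"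
    | P where "P \<subseteq> G" "tight_subgrp K A P"
    using less.prems(2) by fastforce
  then show ?case
  proof cases
    case 1
    then show ?thesis by (rule large_pair[OF A])
  next
    case 2
    show ?thesis
      by (rule large_if_no_tight_subgrp[OF A 2(1) IH[OF A refl] sG _ KG _ 2(2)])
        (use SG Gmin in \<open>simp_all add: S_def\<close>)
  next
    case 3
    define T where "T = {P. P \<subseteq> G \<and> tight_subgrp K A P}"
    have "finite T" "T \<noteq> {}" using 3 by (auto simp: T_def)
    then obtain H where HT: "H \<in> T" "\<forall>P\<in>T. H \<subseteq> P \<longrightarrow> H = P"
      using finite_has_maximal by metis
    then have H: "tight_subgrp K A H" "H \<subseteq> G" and max: "\<forall>P. H \<subset> P \<longrightarrow> P \<subseteq> G \<longrightarrow> \<not> tight_subgrp K A P"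
      unfolding T_def by blast+
    have sH: "subgrp H" and AH: "\<not> A \<subseteq> H" using H(1) by (simp_all add: tight_subgrp_def)
    have noinv: "y + y \<notin> H" if "y \<in> A \<union> uminus ` A" "y \<notin> H" for y
      by (rule tight_subgrp_no_involution[OF A H(1) IH[OF A refl] that])
    obtain B u where B: "aperiodic_half K B" "B \<union> uminus ` B = S" "card B = card A"
      "card (subset_sums B + K) = card (subset_sums A + K)"
      "\<forall>x\<in>B - H. S \<inter> ({x} + H) \<subseteq> B" "card (insert 0 S + H) = card H + 2 * card H * u"
      using aperiodic_half_coset_closed[OF A sH noinv] unfolding S_def by blast
    have tight: "tight_subgrp K B P \<longleftrightarrow> tight_subgrp K A P" for P
      using B(2,3) unfolding S_def by (rule tight_subgrp_cong)
    \<comment> \<open>If \<open>S\<close> met no coset besides \<open>H\<close>, it would lie in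
      \<open>H\<close>, contrary to tightness.\<close>
    have "u \<noteq> 0"
    proof
      assume "u = 0"
      then have "card (insert 0 S + H) = card H" using B(6) by simp
      moreover have "H \<subseteq> insert 0 S + H" using set_zero_plus2[of "insert 0 S" H] by simp
      ultimately have "insert 0 S + H = H" using card_subset_eq[of "insert 0 S + H" H] by simp
      moreover have "insert 0 S \<subseteq> insert 0 S + H" by (rule subset_plus_right[OF subgrp_zero[OF sH]])
      ultimately show False using AH by (auto simp: S_def)
    qed
    then obtain v where v: "u = Suc v" by (cases u) auto
    have "large K B"
    proof (rule tight_subgrp_imp_large[OF B(1) _ IH[OF B(1,3)], unfolded B(2)])
      show "tight_subgrp K B H" using H(1) tight by simp
      show "\<forall>x\<in>B - H. S \<inter> ({x} + H) \<subseteq> B" by (rule B(5))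
      show "card (insert 0 S + H) = card H + 2 * card H * Suc v" using B(6) v by simp
      show "\<forall>P. H \<subset> P \<longrightarrow> P \<subseteq> G \<longrightarrow> \<not> tight_subgrp K B P" using max tight by simp
    qed (use sG SG H(2) Gmin in auto)
    then show ?thesis using B(3,4) by (simp add: large_def)
  qed
qed

theorem theorem1p7:
  fixes S K :: "'a::{ab_group_add, finite} set"
  assumes "symmetric_set S"
    and "K = period (subset_sums S)"
  shows "real (card (subset_sums S))
    \<ge> real (card (S - K)) * (real (card (S - K)) - 2) / 4 + real (card K)"
proof -
  have K: "subgrp K" using assms(2) by (simp add: subgrp_period)
  have KS: "K \<subseteq> subset_sums S" unfolding assms(2) by (rule period_subset[OF zero_in_subset_sums])
  \<comment> \<open>If 2y = 0, then \<open>y\<close> is a period of {0, y}, hence of \<Sigma>(S),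
    and so belongs to \<open>K\<close>.\<close>
  have nfix: "- y \<noteq> y" if "y \<in> S - K" for y
  proof
    assume "- y = y"
    then have "y + y = 0" by (metis add.right_inverse)
    then have "{y} + {0, y} = {0, y}" by (auto simp: set_plus_def)
    then have "{y} + (subset_sums (S - {y}) + {0, y}) = subset_sums (S - {y}) + {0, y}"
      by (metis add.left_commute)
    moreover have "subset_sums S = subset_sums (S - {y}) + {0, y}"
      using that by (intro subset_sums_remove) simp
    ultimately have "y \<in> period (subset_sums S)" by (simp only: period_iff)
    then show False using that assms(2) by simp
  qed
  have negS: "- y \<in> S - K" if "y \<in> S - K" for y
    using that assms(1) subgrp_uminus_iff[OF K] unfolding symmetric_set_def by blast
  have "\<exists>A. A \<union> uminus ` A = S - K \<and> A \<inter> uminus ` A = {}"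
    by (rule involution_transversal) (use negS nfix in auto)
  then obtain A where A: "A \<union> uminus ` A = S - K" "A \<inter> uminus ` A = {}" by blast
  have "S - S \<inter> K = S - K" by blast
  then have split: "subset_sums S = subset_sums (S \<inter> K) + subset_sums (S - K)"
    using subset_sums_Diff[of "S \<inter> K" S] by simp
  \<comment> \<open>The sums of elements of S \<inter> K are absorbed by \<open>K\<close>, so only S
    - K matters.\<close>
  have "subset_sums S = subset_sums S + K" using assms(2) by (simp add: plus_period)
  also have "\<dots> = subset_sums (S \<inter> K) + subset_sums (S - K) + K" by (simp only: split)
  also have "\<dots> = subset_sums (S - K) + (subset_sums (S \<inter> K) + K)" by (simp only: ac_simps)
  also have "subset_sums (S \<inter> K) + K = K"
    using subset_sums_subgrp[OF K, of "S \<inter> K"] zero_in_subset_sums[of "S \<inter> K"]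
    by (intro subgrp_plus_absorb[OF K]) auto
  finally have Z: "subset_sums S = subset_sums (A \<union> uminus ` A) + K" by (simp add: A(1))
  have half: "aperiodic_half K A"
    unfolding aperiodic_half_def
  proof (intro conjI)
    show "A \<inter> K = {}" using A(1) by blast
    show "period (subset_sums (A \<union> uminus ` A) + K) = K" by (simp only: Z[symmetric] assms(2)[symmetric])
  qed (rule A(2))
  define m where "m = card A"
  have n: "card (S - K) = 2 * m" using card_symmetrization[OF A(2)] A(1) by (simp add: m_def)
  have KScard: "card K \<le> card (subset_sums S)" using KS by (intro card_mono) auto
  show ?thesis
  proof (cases "m \<ge> 2")
    case True
    then have "large K A" using half by (intro aperiodic_half_large) (simp_all add: m_def)
    then have "m * (m - 1) + card K \<le> card (subset_sums S)"
      using card_subset_sums_symmetric[OF half] unfolding Z[symmetric] large_def m_def by linarith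
    then have "real (m * (m - 1) + card K) \<le> real (card (subset_sums S))" by (simp only: of_nat_le_iff)
    moreover have "real (m * (m - 1)) = real m * (real m - 1)" using True by (simp add: of_nat_diff)
    ultimately have "real m * (real m - 1) + real (card K) \<le> real (card (subset_sums S))"
      by (simp only: of_nat_add)
    moreover have "real (2 * m) * (real (2 * m) - 2) / 4 = real m * (real m - 1)" by (simp add: field_simps)
    ultimately show ?thesis by (simp only: n)
  next
    \<comment> \<open>The quadratic term vanishes here, and K \<subseteq> \<Sigma>(S)
      suffices.\<close>
    case False
    then have "m = 0 \<or> m = 1" by linarith
    then show ?thesis using KScard n by auto
  qed
qed

end
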